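(* Let $x:M^n\to\mathbb{R}^{n+1}$ be a (locally strongly convex) centroaffine hypersurface with centroaffine metric $h$, Tchebychev form $T^\sharp$ and Tchebychev vector field $T$. Then $T$ is a closed vector field, in the sense that the $1$-form $T^\sharp$ is closed. Moreover, $x:M^n\to\mathbb{R}^{n+1}$ is a Tchebychev hypersurface if and only if $T$ is a conformal vector field with respect to $h$.
   Context: Let $\mathbb{R}^{n+1}$ be the $(n+1)$-dimensional affine space with its canonical flat connection $D$ and origin $O$, and let $M^n$ be a connected smooth $n$-dimensional manifold. An immersion $x:M^n\to\mathbb{R}^{n+1}$ is a centroaffine hypersurface if at each point the position vector $x$ (from $O$) is transversal to the tangent space of the hypersurface. For tangent vector fields $X,Y$ one has the decomposition $$D_Xx_*(Y)=x_*(\nabla_XY)+h(X,Y)(-\varepsilon x),\qquad \varepsilon\in\{1,-1\},$$ where $\nabla$ is the induced (centroaffine) connection and $h$ is the centroaffine metric. All centroaffine hypersurfaces are assumed locally strongly convex, i.e. $h$ is definite, and $\varepsilon$ is chosen so that $h$ is positive definite. Let $\hat\nabla$ be the Levi-Civita connection of $h$ and let $K(X,Y)=K_XY=\nabla_XY-\hat\nabla_XY$ be the difference tensor. The Tchebychev form $T^\sharp$ and the Tchebychev vector field $T$ are defined by $T^\sharp(X)=\frac1n\mathrm{Tr}(K_X)$ and $h(T,X)=T^\sharp(X)$ for all tangent $X$. The Tchebychev operator is $\mathcal{T}(X)=\hat\nabla_XT$. The hypersurface is called a Tchebychev hypersurface if $\mathcal{T}$ is proportional to the identity, i.e. $\mathcal{T}=\frac1n(\mathrm{div}\,T)\,\mathrm{id}$.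 A vector field $V$ is conformal with respect to $h$ if the Lie derivative satisfies $\mathcal{L}_Vh=2fh$ for some smooth function $f$ on $M^n$. *)

theory Defs
  imports "HOL-Analysis.Analysis"
begin

section \<open>Smooth maps between Euclidean spaces\<close>

text \<open>
  \<open>Ck k f S\<close>: on the open set \<open>S\<close> the map \<open>f\<close> has iterated directional derivatives up to
  order \<open>k\<close>, all of them continuous. In finite dimension this is the usual class \<open>C^k\<close>.
\<close>

primrec Ck :: "nat \<Rightarrow> ('a::euclidean_space \<Rightarrow> 'b::real_normed_vector) \<Rightarrow> 'a set \<Rightarrow> bool" where
  "Ck 0 f S \<longleftrightarrow> continuous_on S f"
| "Ck (Suc k) f S \<longleftrightarrow>
     (\<forall>y\<in>S. f differentiable (at y)) \<and> (\<forall>v. Ck k (\<lambda>y. frechet_derivative f (at y) v) S)"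

definition smooth_on :: "'a::euclidean_space set \<Rightarrow> ('a \<Rightarrow> 'b::real_normed_vector) \<Rightarrow> bool" where
  "smooth_on S f \<longleftrightarrow> (\<forall>k. Ck k f S)"


section \<open>Smooth manifolds\<close>

text \<open>
  A manifold is a whole type \<open>'m\<close> (Hausdorff and second countable by its sort) with a smooth
  atlas. A chart is a pair of its domain and a coordinate map, whose values off the domain are
  irrelevant.
\<close>

type_synonym ('m, 'n) chart = "'m set \<times> ('m \<Rightarrow> real ^ 'n)"

definition smooth_map ::
  "('m, 'n::finite) chart set \<Rightarrow> 'm set \<Rightarrow> ('m \<Rightarrow> 'b::real_normed_vector) \<Rightarrow> bool" where
  "smooth_map A W f \<longleftrightarrow>
     (\<forall>(U, \<phi>)\<in>A. smooth_on (\<phi> ` (U \<inter> W)) (f \<circ> inv_into U \<phi>))"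

definition smooth_atlas ::
  "('m::{t2_space, second_countable_topology}, 'n::finite) chart set \<Rightarrow> bool" where
  "smooth_atlas A \<longleftrightarrow>
     (\<Union>(U, \<phi>)\<in>A. U) = UNIV \<and>
     (\<forall>(U, \<phi>)\<in>A. open U \<and> open (\<phi> ` U) \<and> homeomorphism U (\<phi> ` U) \<phi> (inv_into U \<phi>)) \<and>
     (\<forall>(U, \<phi>)\<in>A. smooth_map A U \<phi>)"

text \<open>
  Every point gets a preferred chart around it, and the tangent space at \<open>p\<close> is identified with
  \<open>real ^ 'n\<close> through the preferred chart at \<open>p\<close>: a tangent vector at \<open>p\<close> is given by its
  components in that chart. The preferred chart may jump from point to point, so smoothness of
  a vector field is tested on its components in a fixed chart.
\<close>

definition chart_at :: "('m, 'n::finite) chart set \<Rightarrow> 'm \<Rightarrow> ('m, 'n) chart" where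
  "chart_at A p = (SOME c. c \<in> A \<and> p \<in> fst c)"

definition mdiff ::
  "('m, 'n::finite) chart set \<Rightarrow> ('m \<Rightarrow> 'b::real_normed_vector) \<Rightarrow> 'm \<Rightarrow> real ^ 'n \<Rightarrow> 'b" where
  "mdiff A f p v =
     (case chart_at A p of (U, \<phi>) \<Rightarrow> frechet_derivative (f \<circ> inv_into U \<phi>) (at (\<phi> p)) v)"

type_synonym ('m, 'n) vfield = "'m \<Rightarrow> real ^ 'n"

abbreviation deriv_along ::
  "('m, 'n::finite) chart set \<Rightarrow> ('m, 'n) vfield \<Rightarrow> ('m \<Rightarrow> 'b::real_normed_vector) \<Rightarrow> 'm \<Rightarrow> 'b" where
  "deriv_along A X f \<equiv> (\<lambda>p. mdiff A f p (X p))"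

text \<open>For \<open>q \<in> U\<close>, \<open>mdiff A \<phi> q (X q)\<close> is the vector of components of \<open>X q\<close> in the chart \<open>(U, \<phi>)\<close>.\<close>

definition smooth_field :: "('m, 'n::finite) chart set \<Rightarrow> 'm set \<Rightarrow> ('m, 'n) vfield \<Rightarrow> bool" where
  "smooth_field A W X \<longleftrightarrow> (\<forall>(U, \<phi>)\<in>A. smooth_map A (U \<inter> W) (deriv_along A X \<phi>))"

text \<open>
  The coordinate field \<open>\<Sum>i. v $ i * \<partial>_i\<close> of the preferred chart at \<open>p\<close>. It is smooth on the domain
  of that chart and extends the tangent vector \<open>v\<close> at \<open>p\<close>. Expressions that are tensorial in a
  vector field are evaluated at a tangent vector through this extension.
\<close>

definition coord_field :: "('m, 'n::finite) chart set \<Rightarrow> 'm \<Rightarrow> real ^ 'n \<Rightarrow> ('m, 'n) vfield" where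
  "coord_field A p v q =
     (case chart_at A p of (U, \<phi>) \<Rightarrow>
        frechet_derivative (snd (chart_at A q) \<circ> inv_into U \<phi>) (at (\<phi> q)) v)"

text \<open>
  In the preferred chart \<open>\<phi>\<close> at \<open>p\<close>, the bracket has components
  \<open>X^j * \<partial>_j Y^i - Y^j * \<partial>_j X^i\<close>.
\<close>

definition lie_bracket ::
  "('m, 'n::finite) chart set \<Rightarrow> ('m, 'n) vfield \<Rightarrow> ('m, 'n) vfield \<Rightarrow> ('m, 'n) vfield" where
  "lie_bracket A X Y p =
     (let \<phi> = snd (chart_at A p) in
        mdiff A (deriv_along A Y \<phi>) p (X p) - mdiff A (deriv_along A X \<phi>) p (Y p))"


section \<open>Tensors and connections\<close>

text \<open>
  Identities between vector fields are required for local fields, i.e. fields \<open>X\<close> that are smooth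
  on some open set \<open>W\<close>, at the points of \<open>W\<close>. Values off \<open>W\<close> are arbitrary.
\<close>

type_synonym ('m, 'n) one_form = "'m \<Rightarrow> real ^ 'n \<Rightarrow> real"
type_synonym ('m, 'n) two_tensor = "'m \<Rightarrow> real ^ 'n \<Rightarrow> real ^ 'n \<Rightarrow> real"
type_synonym ('m, 'n) conn = "('m, 'n) vfield \<Rightarrow> ('m, 'n) vfield \<Rightarrow> ('m, 'n) vfield"

definition smooth_one_form ::
  "('m::topological_space, 'n::finite) chart set \<Rightarrow> ('m, 'n) one_form \<Rightarrow> bool" where
  "smooth_one_form A \<omega> \<longleftrightarrow>
     (\<forall>p. linear (\<omega> p)) \<and>
     (\<forall>W X. open W \<and> smooth_field A W X \<longrightarrow> smooth_map A W (\<lambda>p. \<omega> p (X p)))"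

definition ext_deriv ::
  "('m, 'n::finite) chart set \<Rightarrow> ('m, 'n) one_form \<Rightarrow> ('m, 'n) vfield \<Rightarrow> ('m, 'n) vfield \<Rightarrow> 'm \<Rightarrow> real"
  where
  "ext_deriv A \<omega> X Y p =
     deriv_along A X (\<lambda>q. \<omega> q (Y q)) p - deriv_along A Y (\<lambda>q. \<omega> q (X q)) p
       - \<omega> p (lie_bracket A X Y p)"

definition closed_one_form ::
  "('m::topological_space, 'n::finite) chart set \<Rightarrow> ('m, 'n) one_form \<Rightarrow> bool" where
  "closed_one_form A \<omega> \<longleftrightarrow>
     smooth_one_form A \<omega> \<and>
     (\<forall>W X Y. open W \<and> smooth_field A W X \<and> smooth_field A W Y \<longrightarrow>
        (\<forall>p\<in>W. ext_deriv A \<omega> X Y p = 0))"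

definition lie_derivative ::
  "('m, 'n::finite) chart set \<Rightarrow> ('m, 'n) vfield \<Rightarrow> ('m, 'n) two_tensor \<Rightarrow>
     ('m, 'n) vfield \<Rightarrow> ('m, 'n) vfield \<Rightarrow> 'm \<Rightarrow> real" where
  "lie_derivative A V h X Y p =
     deriv_along A V (\<lambda>q. h q (X q) (Y q)) p
       - h p (lie_bracket A V X p) (Y p) - h p (X p) (lie_bracket A V Y p)"

definition conformal_field ::
  "('m::topological_space, 'n::finite) chart set \<Rightarrow> ('m, 'n) two_tensor \<Rightarrow> ('m, 'n) vfield \<Rightarrow> bool"
  where
  "conformal_field A h V \<longleftrightarrow>
     smooth_field A UNIV V \<and>
     (\<exists>f :: 'm \<Rightarrow> real. smooth_map A UNIV f \<and>
        (\<forall>W X Y. open W \<and> smooth_field A W X \<and> smooth_field A W Y \<longrightarrow>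
           (\<forall>p\<in>W. lie_derivative A V h X Y p = 2 * f p * h p (X p) (Y p))))"

definition positive_definite :: "('m, 'n::finite) two_tensor \<Rightarrow> bool" where
  "positive_definite h \<longleftrightarrow> (\<forall>p v. v \<noteq> 0 \<longrightarrow> h p v v > 0)"

definition affine_connection ::
  "('m::topological_space, 'n::finite) chart set \<Rightarrow> ('m, 'n) conn \<Rightarrow> bool" where
  "affine_connection A nab \<longleftrightarrow>
     (\<forall>W X Y. open W \<and> smooth_field A W X \<and> smooth_field A W Y \<longrightarrow>
        smooth_field A W (nab X Y) \<and>
        (\<forall>Z. smooth_field A W Z \<longrightarrow>
           (\<forall>p\<in>W. nab (\<lambda>q. X q + Z q) Y p = nab X Y p + nab Z Y p \<and>
                  nab X (\<lambda>q. Y q + Z q) p = nab X Y p + nab X Z p)) \<and>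
        (\<forall>f :: 'm \<Rightarrow> real. smooth_map A W f \<longrightarrow>
           (\<forall>p\<in>W. nab (\<lambda>q. f q *\<^sub>R X q) Y p = f p *\<^sub>R nab X Y p \<and>
                  nab X (\<lambda>q. f q *\<^sub>R Y q) p =
                    deriv_along A X f p *\<^sub>R Y p + f p *\<^sub>R nab X Y p)))"

definition levi_civita ::
  "('m::topological_space, 'n::finite) chart set \<Rightarrow> ('m, 'n) two_tensor \<Rightarrow> ('m, 'n) conn \<Rightarrow> bool"
  where
  "levi_civita A h nab \<longleftrightarrow>
     affine_connection A nab \<and>
     (\<forall>W X Y. open W \<and> smooth_field A W X \<and> smooth_field A W Y \<longrightarrow>
        (\<forall>p\<in>W. nab X Y p - nab Y X p = lie_bracket A X Y p)) \<and>
     (\<forall>W X Y Z. open W \<and> smooth_field A W X \<and> smooth_field A W Y \<and> smooth_field A W Z \<longrightarrow>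
        (\<forall>p\<in>W. deriv_along A X (\<lambda>q. h q (Y q) (Z q)) p
                = h p (nab X Y p) (Z p) + h p (Y p) (nab X Z p)))"


section \<open>Centroaffine hypersurfaces\<close>

text \<open>The codomain \<open>real ^ 'k\<close> is the affine space with origin \<open>0\<close>.\<close>

definition centroaffine_hypersurface ::
  "('m::{t2_space, second_countable_topology}, 'n::finite) chart set \<Rightarrow> ('m \<Rightarrow> real ^ 'k::finite) \<Rightarrow> bool"
  where
  "centroaffine_hypersurface A x \<longleftrightarrow>
     smooth_atlas A \<and> connected (UNIV :: 'm set) \<and> CARD('k) = CARD('n) + 1 \<and>
     smooth_map A UNIV x \<and> (\<forall>p. inj (mdiff A x p)) \<and>
     (\<forall>p. x p \<notin> range (mdiff A x p))"

text \<open>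
  The vector field \<open>x_*(Y)\<close> along \<open>x\<close> is \<open>deriv_along A Y x\<close>. The flat connection of \<open>real ^ 'k\<close>
  differentiates it componentwise. The equation determines \<open>nab X Y\<close> on \<open>W\<close> and \<open>h\<close> everywhere,
  because \<open>x_*\<close> is injective and \<open>x\<close> is transversal.
\<close>

definition centroaffine_decomposition ::
  "('m::topological_space, 'n::finite) chart set \<Rightarrow> ('m \<Rightarrow> real ^ 'k::finite) \<Rightarrow> real \<Rightarrow>
     ('m, 'n) conn \<Rightarrow> ('m, 'n) two_tensor \<Rightarrow> bool" where
  "centroaffine_decomposition A x eps nab h \<longleftrightarrow>
     (\<forall>W X Y. open W \<and> smooth_field A W X \<and> smooth_field A W Y \<longrightarrow>
        (\<forall>p\<in>W. deriv_along A X (deriv_along A Y x) p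
                = mdiff A x p (nab X Y p) + h p (X p) (Y p) *\<^sub>R (- eps *\<^sub>R x p)))"

definition difference_tensor ::
  "('m, 'n::finite) chart set \<Rightarrow> ('m, 'n) conn \<Rightarrow> ('m, 'n) conn \<Rightarrow>
     'm \<Rightarrow> real ^ 'n \<Rightarrow> real ^ 'n \<Rightarrow> real ^ 'n" where
  "difference_tensor A nab nabh p v w =
     nab (coord_field A p v) (coord_field A p w) p - nabh (coord_field A p v) (coord_field A p w) p"

definition tchebychev_form ::
  "('m, 'n::finite) chart set \<Rightarrow> ('m, 'n) conn \<Rightarrow> ('m, 'n) conn \<Rightarrow> ('m, 'n) one_form" where
  "tchebychev_form A nab nabh p v =
     1 / real CARD('n) * trace (matrix (difference_tensor A nab nabh p v))"

definition tchebychev_field ::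
  "('m, 'n::finite) chart set \<Rightarrow> ('m, 'n) conn \<Rightarrow> ('m, 'n) conn \<Rightarrow> ('m, 'n) two_tensor \<Rightarrow>
     ('m, 'n) vfield \<Rightarrow> bool" where
  "tchebychev_field A nab nabh h T \<longleftrightarrow> (\<forall>p v. h p (T p) v = tchebychev_form A nab nabh p v)"

text \<open>The endomorphism \<open>v \<mapsto> nabh_v V\<close> of the tangent space at \<open>p\<close>.\<close>

definition covariant_diff ::
  "('m, 'n::finite) chart set \<Rightarrow> ('m, 'n) conn \<Rightarrow> ('m, 'n) vfield \<Rightarrow> 'm \<Rightarrow> real ^ 'n \<Rightarrow> real ^ 'n" where
  "covariant_diff A nabh V p v = nabh (coord_field A p v) V p"

definition divergence ::
  "('m, 'n::finite) chart set \<Rightarrow> ('m, 'n) conn \<Rightarrow> ('m, 'n) vfield \<Rightarrow> 'm \<Rightarrow> real" where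
  "divergence A nabh V p = trace (matrix (covariant_diff A nabh V p))"

text \<open>The Tchebychev operator is \<open>covariant_diff A nabh T\<close>.\<close>

definition tchebychev_hypersurface ::
  "('m, 'n::finite) chart set \<Rightarrow> ('m, 'n) conn \<Rightarrow> ('m, 'n) vfield \<Rightarrow> bool" where
  "tchebychev_hypersurface A nabh T \<longleftrightarrow>
     (\<forall>p v. covariant_diff A nabh T p v
              = (1 / real CARD('n) * divergence A nabh T p) *\<^sub>R v)"

end

theory Submission
  imports Defs
begin

text \<open>
  The Tchebychev form is globally exact. Let \<open>\<theta>\<close> be the volume form
  \<open>det (x\<^sub>*X\<^sub>1, \<dots>, x\<^sub>*X\<^sub>n, x)\<close>, which is parallel for \<open>nab\<close>, and \<open>vol\<close> the volume form of \<open>h\<close>,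
  parallel for \<open>nabh\<close>. In a coordinate frame the logarithmic derivatives of \<open>\<theta>\<close> and \<open>vol\<close> are the
  traces of the two connections, so the trace of the difference tensor is the differential of
  \<open>ln \<bar>\<theta> / vol\<bar>\<close>, a function that does not depend on the frame.
  Closedness says that \<open>X \<mapsto> nabh X T\<close> is symmetric with respect to \<open>h\<close>; hence the Lie derivative
  of \<open>h\<close> along \<open>T\<close> is \<open>2 * h (nabh X T) Y\<close>, and it is proportional to \<open>h\<close> exactly when
  \<open>nabh X T\<close> is proportional to \<open>X\<close>.
\<close>

section \<open>Calculus of smooth maps\<close>

text \<open>No regularity of \<open>h\<close> is assumed, and \<open>T\<close> is given only through
  its pointwise products under \<open>h\<close>. Since \<open>h\<close> is differentiated and the
  identities of \<open>nabh\<close> apply to smooth fields only, smoothness of both has to be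
  produced. In a chart, the decomposition is a linear system whose unknowns include
  \<open>h\<close>, and \<open>h (T, .)\<close> gives one for the components of \<open>T\<close>;
  Cramer's rule solves both in smooth terms. Comparing coefficients of \<open>x\<close> also yields
  symmetry and bilinearity of \<open>h\<close>. Preferred charts jump from point to point, so
  neither volume form, evaluated on the preferred bases, need be a smooth function. Their ratio is:
  a frame change with matrix \<open>J\<close> multiplies \<open>\<theta>\<close> by
  \<open>det J\<close> and \<open>vol\<close> by \<open>\<bar>det J\<bar>\<close>, so near each
  point the ratio can be computed in a smooth coordinate frame. Logarithms of squares absorb all
  signs and ask only for nonzero determinants.\<close>

lemma frechet_derivative_eqI:
  "(f has_derivative f') (at y) \<Longrightarrow> frechet_derivative f (at y) = f'"
  using frechet_derivative_at by metis

lemma Ck_cong: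
  assumes "open S" "\<And>y. y \<in> S \<Longrightarrow> f y = g y"
  shows "Ck k f S \<longleftrightarrow> Ck k g S"
proof -
  have "Ck k g S" if "Ck k f S" "\<And>y. y \<in> S \<Longrightarrow> f y = g y" for f g
    using that
  proof (induction k arbitrary: f g)
    case 0
    then show ?case using continuous_on_cong by (metis Ck.simps(1))
  next
    case (Suc k)
    have D: "(g has_derivative frechet_derivative f (at y)) (at y)" if "y \<in> S" for y
      using Suc.prems that assms(1) has_derivative_transform_within_open
      by (metis Ck.simps(2) frechet_derivative_works)
    then have eq: "frechet_derivative f (at y) = frechet_derivative g (at y)" if "y \<in> S" for y
      using that frechet_derivative_at by blast
    have "Ck k (\<lambda>y. frechet_derivative g (at y) v) S" for v
      by (rule Suc.IH[of "\<lambda>y. frechet_derivative f (at y) v"]) (use Suc.prems(1) eq in auto)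
    then show ?case
      using D by (auto simp: differentiable_def)
  qed
  then show ?thesis using assms(2) by metis
qed

text \<open>Most closure rules below are inductions on \<open>k\<close> through this one: a calculus
  rule exhibits a derivative, whose values in each fixed direction are then shown to be of class
  \<open>k\<close>.\<close>

lemma Ck_SucI:
  assumes "open S" "\<And>y. y \<in> S \<Longrightarrow> (f has_derivative f' y) (at y)" "\<And>v. Ck k (\<lambda>y. f' y v) S"
  shows "Ck (Suc k) f S"
proof -
  have "Ck k (\<lambda>y. frechet_derivative f (at y) v) S" for v
    using assms(2) Ck_cong[OF assms(1), of "\<lambda>y. frechet_derivative f (at y) v" "\<lambda>y. f' y v"]
      assms(3) frechet_derivative_eqI by metis
  then show ?thesis using assms(2) by (auto simp: differentiable_def)
qed

lemma Ck_SucD: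
  assumes "Ck (Suc k) f S"
  shows "\<And>y. y \<in> S \<Longrightarrow> (f has_derivative frechet_derivative f (at y)) (at y)"
    and "Ck k (\<lambda>y. frechet_derivative f (at y) v) S"
  using assms by (auto simp: frechet_derivative_works)

lemma Ck_Suc_imp: "Ck (Suc k) f S \<Longrightarrow> Ck k f S"
proof (induction k arbitrary: f)
  case 0
  then show ?case
    by (auto intro!: differentiable_imp_continuous_on differentiable_at_imp_differentiable_on)
qed (use Ck.simps(2) in blast)

lemma Ck_const: "Ck k (\<lambda>y. c) S"
  by (induction k arbitrary: c) auto

lemma Ck_add:
  assumes "open S" "Ck k f S" "Ck k g S"
  shows "Ck k (\<lambda>y. f y + g y) S"
  using assms(2,3)
proof (induction k arbitrary: f g)
  case 0
  then show ?case by (auto intro: continuous_intros)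
next
  case (Suc k)
  note f = Ck_SucD[OF Suc.prems(1)] and g = Ck_SucD[OF Suc.prems(2)]
  show ?case
    by (rule Ck_SucI[OF assms(1) has_derivative_add[OF f(1) g(1)]]) (auto intro: Suc.IH f(2) g(2))
qed

lemma Ck_sum:
  assumes "open S" "\<And>i. i \<in> I \<Longrightarrow> Ck k (f i) S"
  shows "Ck k (\<lambda>y. \<Sum>i\<in>I. f i y) S"
  using assms(2)
  by (induction I rule: infinite_finite_induct) (auto intro: Ck_add assms(1) Ck_const)

lemma (in bounded_bilinear) Ck_bilinear:
  fixes f :: "'d::euclidean_space \<Rightarrow> 'a"
  assumes "open S" "Ck k f S" "Ck k g S"
  shows "Ck k (\<lambda>y. prod (f y) (g y)) S"
  using assms(2,3)
proof (induction k arbitrary: f g)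
  case 0
  then show ?case by (auto intro: continuous_on)
next
  case (Suc k)
  note f = Ck_SucD[OF Suc.prems(1)] and g = Ck_SucD[OF Suc.prems(2)]
  show ?case
  proof (rule Ck_SucI[OF assms(1) FDERIV[OF f(1) g(1)]])
    fix v
    show "Ck k (\<lambda>y. prod (f y) (frechet_derivative g (at y) v) + prod (frechet_derivative f (at y) v) (g y)) S"
      by (intro Ck_add assms(1) Suc.IH f(2) g(2) Ck_Suc_imp[OF Suc.prems(1)] Ck_Suc_imp[OF Suc.prems(2)])
  qed
qed

lemma (in bounded_linear) Ck_linear:
  fixes g :: "'d::euclidean_space \<Rightarrow> 'a"
  assumes "open S" "Ck k g S"
  shows "Ck k (\<lambda>y. f (g y)) S"
  using assms(2)
proof (induction k arbitrary: g)
  case 0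
  then show ?case by (auto intro: continuous_on)
next
  case (Suc k)
  note g = Ck_SucD[OF Suc.prems(1)]
  show ?case
    by (rule Ck_SucI[OF assms(1) has_derivative[OF g(1)]]) (auto intro: Suc.IH g(2))
qed

lemma linear_euclidean_expand:
  fixes L :: "'a::euclidean_space \<Rightarrow> 'b::real_normed_vector"
  assumes "linear L"
  shows "L v = (\<Sum>b\<in>Basis. (v \<bullet> b) *\<^sub>R L b)"
proof -
  have "L v = L (\<Sum>b\<in>Basis. (v \<bullet> b) *\<^sub>R b)" by (simp add: euclidean_representation)
  then show ?thesis using assms by (simp add: linear_sum linear_scale)
qed

lemma Ck_compose:
  fixes f :: "'a::euclidean_space \<Rightarrow> 'b::euclidean_space" and g :: "'b \<Rightarrow> 'c::real_normed_vector"
  assumes "open S" "open R" "f ` S \<subseteq> R" "Ck k f S" "Ck k g R"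
  shows "Ck k (\<lambda>y. g (f y)) S"
  using assms(4,5)
proof (induction k arbitrary: g)
  case 0
  then show ?case using assms(3) by (auto intro: continuous_on_compose2)
next
  case (Suc k)
  note f = Ck_SucD[OF Suc.prems(1)] and g = Ck_SucD[OF Suc.prems(2)]
  \<comment> \<open>\<open>Ck\<close> tests derivatives of \<open>g\<close> in fixed directions
    only, while the chain rule applies them to the moving vector
    \<open>frechet_derivative f (at y) v\<close>; expanding in \<open>Basis\<close> separates the
    two.\<close>
  let ?D = "\<lambda>y v. \<Sum>b\<in>Basis. (frechet_derivative f (at y) v \<bullet> b) *\<^sub>R frechet_derivative g (at (f y)) b"
  show ?case
  proof (rule Ck_SucI[OF assms(1)])
    fix y assume "y \<in> S"
    then have "f y \<in> R" using assms(3) by auto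
    have "((\<lambda>y. g (f y)) has_derivative (\<lambda>v. frechet_derivative g (at (f y)) (frechet_derivative f (at y) v))) (at y)"
      using diff_chain_at[OF f(1)[OF \<open>y \<in> S\<close>] g(1)[OF \<open>f y \<in> R\<close>]] by (simp add: o_def)
    moreover have "(\<lambda>v. frechet_derivative g (at (f y)) (frechet_derivative f (at y) v)) = ?D y"
      by (rule ext) (rule linear_euclidean_expand[OF has_derivative_linear[OF g(1)[OF \<open>f y \<in> R\<close>]]])
    ultimately show "((\<lambda>y. g (f y)) has_derivative ?D y) (at y)" by metis
  next
    fix v
    show "Ck k (\<lambda>y. ?D y v) S"
      by (intro Ck_sum assms(1) bounded_bilinear.Ck_bilinear[OF bounded_bilinear_scaleR]
          bounded_linear.Ck_linear[OF bounded_linear_inner_left] f(2) Suc.IH g(2) Ck_Suc_imp[OF Suc.prems(1)])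
  qed
qed

text \<open>The derivative \<open>- f' / f^2\<close> contains the function itself, but one order
  lower, so the induction closes.\<close>

lemma Ck_inverse:
  fixes f :: "'a::euclidean_space \<Rightarrow> real"
  assumes "open S" "\<And>y. y \<in> S \<Longrightarrow> f y \<noteq> 0" "Ck k f S"
  shows "Ck k (\<lambda>y. inverse (f y)) S"
  using assms(3)
proof (induction k)
  case 0
  then show ?case using assms(2) by (auto intro: continuous_intros)
next
  case (Suc k)
  note f = Ck_SucD[OF Suc.prems] and m = bounded_bilinear.Ck_bilinear[OF bounded_bilinear_mult assms(1)]
  have inv: "Ck k (\<lambda>y. inverse (f y)) S" using Suc.IH Ck_Suc_imp Suc.prems by blast
  show ?case
  proof (rule Ck_SucI[OF assms(1)])
    fix y assume "y \<in> S"
    show "((\<lambda>y. inverse (f y)) has_derivative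
        (\<lambda>v. (- 1) * (inverse (f y) * frechet_derivative f (at y) v * inverse (f y)))) (at y)"
      using Deriv.has_derivative_inverse[OF assms(2)[OF \<open>y \<in> S\<close>] f(1)[OF \<open>y \<in> S\<close>]] by simp
  qed (rule m[OF Ck_const m[OF m[OF inv f(2)] inv]])
qed

text \<open>One differentiation turns \<open>ln f\<close> into \<open>f' / f\<close>, so a case
  split on \<open>k\<close> replaces an induction.\<close>

lemma Ck_ln:
  fixes f :: "'a::euclidean_space \<Rightarrow> real"
  assumes "open S" "\<And>y. y \<in> S \<Longrightarrow> f y > 0" "Ck k f S"
  shows "Ck k (\<lambda>y. ln (f y)) S"
proof (cases k)
  case 0
  then show ?thesis using assms by (force intro!: continuous_on_ln)
next
  case (Suc n)
  note f = Ck_SucD[OF assms(3)[unfolded Suc]] and m = bounded_bilinear.Ck_bilinear[OF bounded_bilinear_mult assms(1)]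
  show ?thesis unfolding Suc
  proof (rule Ck_SucI[OF assms(1)])
    fix y assume "y \<in> S"
    show "((\<lambda>y. ln (f y)) has_derivative (\<lambda>v. frechet_derivative f (at y) v * inverse (f y))) (at y)"
      by (rule has_derivative_ln[OF assms(2) f(1)]) (use \<open>y \<in> S\<close> in auto)
  next
    show "Ck n (\<lambda>y. frechet_derivative f (at y) v * inverse (f y)) S" for v
      by (rule m[OF f(2) Ck_inverse[OF assms(1) _ Ck_Suc_imp[OF assms(3)[unfolded Suc]]]])
        (use assms(2) in force)
  qed
qed

section \<open>Closure properties of smooth maps\<close>

lemma smooth_on_cong:
  "open S \<Longrightarrow> (\<And>y. y \<in> S \<Longrightarrow> f y = g y) \<Longrightarrow> smooth_on S f \<longleftrightarrow> smooth_on S g"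
  unfolding smooth_on_def using Ck_cong by metis

lemma smooth_on_transform:
  "open S \<Longrightarrow> smooth_on S f \<Longrightarrow> (\<And>y. y \<in> S \<Longrightarrow> f y = g y) \<Longrightarrow> smooth_on S g"
  using smooth_on_cong by metis

lemma smooth_on_subset: "smooth_on S f \<Longrightarrow> R \<subseteq> S \<Longrightarrow> smooth_on R f"
proof -
  have "Ck k f S \<Longrightarrow> R \<subseteq> S \<Longrightarrow> Ck k f R" for k
    by (induction k arbitrary: f) (auto intro: continuous_on_subset)
  then show "smooth_on S f \<Longrightarrow> R \<subseteq> S \<Longrightarrow> smooth_on R f" unfolding smooth_on_def by auto
qed

lemma smooth_on_has_derivative:
  "smooth_on S f \<Longrightarrow> y \<in> S \<Longrightarrow> (f has_derivative frechet_derivative f (at y)) (at y)"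
  unfolding smooth_on_def using Ck_SucD(1) by blast

lemma smooth_on_differentiable: "smooth_on S f \<Longrightarrow> y \<in> S \<Longrightarrow> f differentiable at y"
  using smooth_on_has_derivative differentiableI by blast

lemma smooth_on_linear_derivative: "smooth_on S f \<Longrightarrow> y \<in> S \<Longrightarrow> linear (frechet_derivative f (at y))"
  using smooth_on_has_derivative has_derivative_linear by blast

lemma smooth_on_continuous_on: "smooth_on S f \<Longrightarrow> continuous_on S f"
  unfolding smooth_on_def using Ck.simps(1) by blast

lemma smooth_on_frechet_derivative: "smooth_on S f \<Longrightarrow> smooth_on S (\<lambda>y. frechet_derivative f (at y) v)"
  unfolding smooth_on_def using Ck_SucD(2) by blast

lemma smooth_on_const: "smooth_on S (\<lambda>y. c)"
  unfolding smooth_on_def using Ck_const by blast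

lemma smooth_on_add: "open S \<Longrightarrow> smooth_on S f \<Longrightarrow> smooth_on S g \<Longrightarrow> smooth_on S (\<lambda>y. f y + g y)"
  unfolding smooth_on_def using Ck_add by blast

lemma smooth_on_sum: "open S \<Longrightarrow> (\<And>i. i \<in> I \<Longrightarrow> smooth_on S (f i)) \<Longrightarrow> smooth_on S (\<lambda>y. \<Sum>i\<in>I. f i y)"
  by (simp add: smooth_on_def Ck_sum)

lemma smooth_on_mult:
  fixes f g :: "'a::euclidean_space \<Rightarrow> real"
  shows "open S \<Longrightarrow> smooth_on S f \<Longrightarrow> smooth_on S g \<Longrightarrow> smooth_on S (\<lambda>y. f y * g y)"
  by (simp add: smooth_on_def bounded_bilinear.Ck_bilinear[OF bounded_bilinear_mult])

lemma smooth_on_scaleR: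
  "open S \<Longrightarrow> smooth_on S f \<Longrightarrow> smooth_on S g \<Longrightarrow> smooth_on S (\<lambda>y. f y *\<^sub>R g y)"
  by (simp add: smooth_on_def bounded_bilinear.Ck_bilinear[OF bounded_bilinear_scaleR])

lemma smooth_on_inner_const: "open S \<Longrightarrow> smooth_on S f \<Longrightarrow> smooth_on S (\<lambda>y. f y \<bullet> c)"
  by (simp add: smooth_on_def bounded_linear.Ck_linear[OF bounded_linear_inner_left])

lemma smooth_on_diff:
  assumes "open S" "smooth_on S f" "smooth_on S g"
  shows "smooth_on S (\<lambda>y. f y - g y)"
  using smooth_on_add[OF assms(1,2) smooth_on_scaleR[OF assms(1) smooth_on_const[of S "- 1"] assms(3)]] by simp

lemma smooth_on_vec_nth: "open S \<Longrightarrow> smooth_on S f \<Longrightarrow> smooth_on S (\<lambda>y. f y $ i)"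
  by (simp add: smooth_on_def bounded_linear.Ck_linear[OF bounded_linear_vec_nth])

lemma smooth_on_vec_lambda:
  fixes f :: "'i::finite \<Rightarrow> 'a::euclidean_space \<Rightarrow> real"
  assumes "open S" "\<And>i. smooth_on S (f i)"
  shows "smooth_on S (\<lambda>y. \<chi> i. f i y)"
proof -
  have "(\<lambda>y. \<chi> i. f i y) = (\<lambda>y. \<Sum>i\<in>UNIV. f i y *\<^sub>R axis i 1)"
    by (simp add: fun_eq_iff vec_eq_iff axis_def if_distrib cong: if_cong)
  then show ?thesis using assms by (auto intro!: smooth_on_sum smooth_on_scaleR smooth_on_const)
qed

lemma smooth_on_compose:
  fixes f :: "'a::euclidean_space \<Rightarrow> 'b::euclidean_space"
  shows "open S \<Longrightarrow> open R \<Longrightarrow> f ` S \<subseteq> R \<Longrightarrow> smooth_on S f \<Longrightarrow> smooth_on R g \<Longrightarrow> smooth_on S (\<lambda>y. g (f y))"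
  unfolding smooth_on_def using Ck_compose by blast

lemma smooth_on_divide:
  fixes f g :: "'a::euclidean_space \<Rightarrow> real"
  assumes "open S" "smooth_on S f" "smooth_on S g" "\<And>y. y \<in> S \<Longrightarrow> g y \<noteq> 0"
  shows "smooth_on S (\<lambda>y. f y / g y)"
proof -
  have "smooth_on S (\<lambda>y. inverse (g y))" using assms unfolding smooth_on_def by (auto intro: Ck_inverse)
  then show ?thesis using assms unfolding divide_inverse by (intro smooth_on_mult)
qed

lemma smooth_on_ln:
  fixes f :: "'a::euclidean_space \<Rightarrow> real"
  shows "open S \<Longrightarrow> smooth_on S f \<Longrightarrow> (\<And>y. y \<in> S \<Longrightarrow> f y > 0) \<Longrightarrow> smooth_on S (\<lambda>y. ln (f y))"
  unfolding smooth_on_def using Ck_ln by blast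

lemma smooth_on_prod:
  fixes f :: "'i \<Rightarrow> 'a::euclidean_space \<Rightarrow> real"
  assumes "open S" "\<And>i. i \<in> I \<Longrightarrow> smooth_on S (f i)"
  shows "smooth_on S (\<lambda>y. \<Prod>i\<in>I. f i y)"
  using assms(2)
  by (induction I rule: infinite_finite_induct) (auto intro: smooth_on_mult assms(1) smooth_on_const)

lemma smooth_on_det:
  fixes M :: "'a::euclidean_space \<Rightarrow> real^'i^'i"
  assumes "open S" "\<And>i j. smooth_on S (\<lambda>y. M y $ i $ j)"
  shows "smooth_on S (\<lambda>y. det (M y))"
  unfolding det_def
  by (intro smooth_on_sum smooth_on_mult smooth_on_prod smooth_on_const assms)

section \<open>Derivatives in variable directions and symmetry of second derivatives\<close>

lemma smooth_on_derivative_along: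
  fixes f :: "'a::euclidean_space \<Rightarrow> 'b::real_normed_vector"
  assumes "open S" "smooth_on S f" "smooth_on S \<xi>"
  shows "smooth_on S (\<lambda>y. frechet_derivative f (at y) (\<xi> y))"
proof -
  have "smooth_on S (\<lambda>y. \<Sum>b\<in>Basis. (\<xi> y \<bullet> b) *\<^sub>R frechet_derivative f (at y) b)"
    by (intro smooth_on_sum smooth_on_scaleR smooth_on_inner_const smooth_on_frechet_derivative assms)
  moreover have "(\<Sum>b\<in>Basis. (\<xi> y \<bullet> b) *\<^sub>R frechet_derivative f (at y) b) = frechet_derivative f (at y) (\<xi> y)"
    if "y \<in> S" for y
    by (rule linear_euclidean_expand[symmetric]) (rule smooth_on_linear_derivative[OF assms(2) that])
  ultimately show ?thesis by (rule smooth_on_transform[OF assms(1)])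
qed

text \<open>A Leibniz rule with frozen direction: in the first summand \<open>\<xi> y\<close> is
  held constant, so that it is a genuine second derivative, open to the symmetry lemma.\<close>

lemma frechet_derivative_along:
  fixes f :: "'a::euclidean_space \<Rightarrow> 'b::real_normed_vector"
  assumes "open S" "smooth_on S f" "smooth_on S \<xi>" "y \<in> S"
  shows "frechet_derivative (\<lambda>z. frechet_derivative f (at z) (\<xi> z)) (at y) v =
    frechet_derivative (\<lambda>z. frechet_derivative f (at z) (\<xi> y)) (at y) v +
    frechet_derivative f (at y) (frechet_derivative \<xi> (at y) v)"
proof -
  let ?D = "\<lambda>y. frechet_derivative f (at y)" 
  let ?g = "\<lambda>c y. \<Sum>b\<in>Basis. (c y \<bullet> b) *\<^sub>R ?D y b"
  let ?g' = "\<lambda>c c'. \<Sum>b\<in>Basis. (c y \<bullet> b) *\<^sub>R frechet_derivative (\<lambda>y. ?D y b) (at y) v + (c' \<bullet> b) *\<^sub>R ?D y b"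
  have lin: "?D y w = (\<Sum>b\<in>Basis. (w \<bullet> b) *\<^sub>R ?D y b)" if "y \<in> S" for y w
    by (rule linear_euclidean_expand) (rule smooth_on_linear_derivative[OF assms(2) that])
  \<comment> \<open>Stated for every \<open>c\<close>, because the cases \<open>c = \<xi>\<close>
    and \<open>c\<close> constant with value \<open>\<xi> y\<close> are compared at the end.\<close>
  have D: "frechet_derivative (\<lambda>y. ?D y (c y)) (at y) v = ?g' c (frechet_derivative c (at y) v)"
    if "smooth_on S c" for c
  proof -
    have "(?g c has_derivative (\<lambda>v. \<Sum>b\<in>Basis. (c y \<bullet> b) *\<^sub>R frechet_derivative (\<lambda>y. ?D y b) (at y) v
        + (frechet_derivative c (at y) v \<bullet> b) *\<^sub>R ?D y b)) (at y)"
      by (intro has_derivative_sum has_derivative_scaleR has_derivative_inner_left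
          smooth_on_has_derivative[OF that assms(4)]
          smooth_on_has_derivative[OF smooth_on_frechet_derivative[OF assms(2)] assms(4)])
    moreover have "?g c z = ?D z (c z)" if "z \<in> S" for z
      by (rule lin[OF that, symmetric])
    ultimately have "((\<lambda>y. ?D y (c y)) has_derivative (\<lambda>v. \<Sum>b\<in>Basis. (c y \<bullet> b) *\<^sub>R frechet_derivative (\<lambda>y. ?D y b) (at y) v
        + (frechet_derivative c (at y) v \<bullet> b) *\<^sub>R ?D y b)) (at y)"
      by (rule has_derivative_transform_within_open[OF _ assms(1,4)])
    from frechet_derivative_eqI[OF this] show ?thesis by (simp only:)
  qed
  show ?thesis
    using D[OF assms(3)] D[OF smooth_on_const[of S "\<xi> y"]]
      lin[OF assms(4), of "frechet_derivative \<xi> (at y) v"]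
    by (simp add: sum.distrib)
qed

text \<open>The second difference of \<open>f\<close> over the parallelogram spanned by
  \<open>e\<close> times \<open>v\<close> and \<open>e\<close> times \<open>w\<close> is symmetric
  in \<open>v\<close> and \<open>w\<close>. Two mean value theorems make it \<open>e^2\<close> times
  either mixed derivative at some nearby point, and continuity carries the equality to
  \<open>y\<close>.\<close>

lemma symmetric_second_derivative_real:
  fixes f :: "'a::euclidean_space \<Rightarrow> real"
  assumes "open S" "smooth_on S f" "y \<in> S"
  shows "frechet_derivative (\<lambda>y. frechet_derivative f (at y) v) (at y) w
       = frechet_derivative (\<lambda>y. frechet_derivative f (at y) w) (at y) v"
proof -
  let ?D = "\<lambda>v y. frechet_derivative f (at y) v"
  let ?DD = "\<lambda>v w y. frechet_derivative (?D v) (at y) w"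
  obtain r where r: "r > 0" "ball y r \<subseteq> S" using assms(1,3) open_contains_ball by blast
  have bound: "y + s *\<^sub>R v + t *\<^sub>R w \<in> ball y d"
    if "\<bar>s\<bar> \<le> e" "\<bar>t\<bar> \<le> e" "e * (norm v + norm w) < d" for s t e d v w
  proof -
    have "norm (s *\<^sub>R v + t *\<^sub>R w) \<le> \<bar>s\<bar> * norm v + \<bar>t\<bar> * norm w"
      using norm_triangle_ineq[of "s *\<^sub>R v" "t *\<^sub>R w"] by simp
    also have "\<dots> \<le> e * norm v + e * norm w"
      using that by (intro add_mono mult_right_mono) auto
    finally have "norm (s *\<^sub>R v + t *\<^sub>R w) < d" using that(3) by (simp add: algebra_simps)
    then have "dist (y + (s *\<^sub>R v + t *\<^sub>R w)) y < d" by (simp add: dist_norm)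
    then show ?thesis by (simp add: dist_commute add.assoc)
  qed
  have line: "((\<lambda>s. g (a + s *\<^sub>R v)) has_real_derivative frechet_derivative g (at (a + s *\<^sub>R v)) v) (at s)"
    if "smooth_on S g" "a + s *\<^sub>R v \<in> S" for g :: "'a \<Rightarrow> real" and a v s
  proof -
    have "((\<lambda>s. a + s *\<^sub>R v) has_derivative (\<lambda>s. s *\<^sub>R v)) (at s)" by (auto intro!: derivative_eq_intros)
    from diff_chain_at[OF this smooth_on_has_derivative[OF that]]
    show ?thesis
      by (simp add: has_field_derivative_def o_def linear_scale[OF smooth_on_linear_derivative[OF that]] mult.commute[of _ "frechet_derivative g (at (a + s *\<^sub>R v)) v"] fun_eq_iff)
  qed
  have mvt: "\<exists>s t. 0 < s \<and> s < e \<and> 0 < t \<and> t < e \<and>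
      f (y + e *\<^sub>R v + e *\<^sub>R w) - f (y + e *\<^sub>R v) - f (y + e *\<^sub>R w) + f y
      = e * e * ?DD v w (y + s *\<^sub>R v + t *\<^sub>R w)"
    if e: "e > 0" "e * (norm v + norm w) < r" for e v w
  proof -
    have inS: "y + s *\<^sub>R v + t *\<^sub>R w \<in> S" if "0 \<le> s" "s \<le> e" "0 \<le> t" "t \<le> e" for s t
      using bound[of s e t v w r] that e r by auto
    have inS0: "y + s *\<^sub>R v \<in> S" if "0 \<le> s" "s \<le> e" for s
      using inS[of s 0] that e by auto
    have "\<exists>s. 0 < s \<and> s < e \<and>
      (f (y + e *\<^sub>R w + e *\<^sub>R v) - f (y + e *\<^sub>R v)) - (f (y + e *\<^sub>R w + 0 *\<^sub>R v) - f (y + 0 *\<^sub>R v))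
      = (e - 0) * (?D v (y + e *\<^sub>R w + s *\<^sub>R v) - ?D v (y + s *\<^sub>R v))"
      using e inS[of _ e] inS0
      by (intro MVT2[where f="\<lambda>s. f (y + e *\<^sub>R w + s *\<^sub>R v) - f (y + s *\<^sub>R v)"] DERIV_diff line assms(2))
        (auto simp: algebra_simps)
    then obtain s where s: "0 < s" "s < e"
      "(f (y + e *\<^sub>R w + e *\<^sub>R v) - f (y + e *\<^sub>R v)) - (f (y + e *\<^sub>R w + 0 *\<^sub>R v) - f (y + 0 *\<^sub>R v))
      = (e - 0) * (?D v (y + e *\<^sub>R w + s *\<^sub>R v) - ?D v (y + s *\<^sub>R v))" by auto
    have "\<exists>t. 0 < t \<and> t < e \<and>
      ?D v (y + s *\<^sub>R v + e *\<^sub>R w) - ?D v (y + s *\<^sub>R v + 0 *\<^sub>R w)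
      = (e - 0) * ?DD v w (y + s *\<^sub>R v + t *\<^sub>R w)"
      using e inS s
      by (intro MVT2[where f="\<lambda>t. ?D v (y + s *\<^sub>R v + t *\<^sub>R w)"] line smooth_on_frechet_derivative assms(2)) auto
    then obtain t where t: "0 < t" "t < e"
      "?D v (y + s *\<^sub>R v + e *\<^sub>R w) - ?D v (y + s *\<^sub>R v + 0 *\<^sub>R w)
      = (e - 0) * ?DD v w (y + s *\<^sub>R v + t *\<^sub>R w)" by auto
    have "f (y + e *\<^sub>R v + e *\<^sub>R w) - f (y + e *\<^sub>R v) - f (y + e *\<^sub>R w) + f y
      = e * (e * ?DD v w (y + s *\<^sub>R v + t *\<^sub>R w))"
      using s(3) t(3) by (simp add: add.commute add.left_commute)
    then show ?thesis using s(1,2) t(1,2) by (auto simp: mult.assoc)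
  qed
  have close: "\<exists>d>0. \<forall>z\<in>ball y d. \<bar>?DD v w z - ?DD v w y\<bar> < e" if "e > 0" for e v w
  proof -
    have "isCont (?DD v w) y"
      using smooth_on_continuous_on[OF smooth_on_frechet_derivative[OF smooth_on_frechet_derivative[OF assms(2)]]]
        assms(1,3) continuous_on_eq_continuous_at by blast
    then obtain d where "d > 0" "\<forall>z. dist z y < d \<longrightarrow> dist (?DD v w z) (?DD v w y) < e"
      using \<open>e > 0\<close> unfolding continuous_at_eps_delta by blast
    then show ?thesis by (intro exI[of _ d]) (auto simp: dist_real_def dist_commute)
  qed
  show ?thesis
  proof (rule ccontr)
    assume ne: "?DD v w y \<noteq> ?DD w v y"
    define \<epsilon> where "\<epsilon> = \<bar>?DD v w y - ?DD w v y\<bar> / 2"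
    have "\<epsilon> > 0" using ne by (simp add: \<epsilon>_def)
    obtain d1 d2 where d: "d1 > 0" "d2 > 0" "\<forall>z\<in>ball y d1. \<bar>?DD v w z - ?DD v w y\<bar> < \<epsilon>"
      "\<forall>z\<in>ball y d2. \<bar>?DD w v z - ?DD w v y\<bar> < \<epsilon>"
      using close[OF \<open>\<epsilon> > 0\<close>] by meson
    \<comment> \<open>The summand \<open>1\<close> keeps \<open>N\<close> positive even for zero
      vectors. Since \<open>N\<close> exceeds \<open>norm v + norm w\<close>, the choice of
      \<open>e\<close> keeps the parallelograms inside the balls of radius \<open>r\<close>,
      \<open>d1\<close> and \<open>d2\<close>.\<close>
    define N where "N = norm v + norm w + 1"
    define m where "m = min r (min d1 d2)"
    define e where "e = m / (2 * N)"
    have N: "N > 0" unfolding N_def by (smt (verit) norm_ge_zero)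
    have m: "m > 0" using d r by (simp add: m_def)
    have e: "e > 0" using N m by (simp add: e_def)
    have "e * (norm v + norm w) < e * N" using e by (simp add: N_def)
    also have "e * N < m" using N m by (simp add: e_def)
    finally have em: "e * (norm v + norm w) < m" .
    then have er: "e * (norm v + norm w) < r" "e * (norm w + norm v) < r" 
      by (auto simp: m_def add.commute)
    obtain s t where st: "0 < s" "s < e" "0 < t" "t < e"
      "f (y + e *\<^sub>R v + e *\<^sub>R w) - f (y + e *\<^sub>R v) - f (y + e *\<^sub>R w) + f y
      = e * e * ?DD v w (y + s *\<^sub>R v + t *\<^sub>R w)" using mvt[OF e er(1)] by blast
    obtain s' t' where st': "0 < s'" "s' < e" "0 < t'" "t' < e"
      "f (y + e *\<^sub>R w + e *\<^sub>R v) - f (y + e *\<^sub>R w) - f (y + e *\<^sub>R v) + f y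
      = e * e * ?DD w v (y + s' *\<^sub>R w + t' *\<^sub>R v)" using mvt[OF e er(2)] by blast
    have "e * e * ?DD v w (y + s *\<^sub>R v + t *\<^sub>R w) = e * e * ?DD w v (y + s' *\<^sub>R w + t' *\<^sub>R v)"
      using st(5) st'(5) by (simp add: algebra_simps)
    then have eq: "?DD v w (y + s *\<^sub>R v + t *\<^sub>R w) = ?DD w v (y + s' *\<^sub>R w + t' *\<^sub>R v)"
      using e by simp
    have "y + s *\<^sub>R v + t *\<^sub>R w \<in> ball y d1"
      using bound[of s e t v w d1] st em by (auto simp: m_def)
    moreover have "y + s' *\<^sub>R w + t' *\<^sub>R v \<in> ball y d2"
      using bound[of s' e t' w v d2] st' em by (auto simp: m_def add.commute)
    ultimately show False using d(3,4) eq unfolding \<epsilon>_def by (smt (verit) field_sum_of_halves)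
  qed
qed

lemma symmetric_second_derivative:
  fixes f :: "'a::euclidean_space \<Rightarrow> 'b::euclidean_space"
  assumes "open S" "smooth_on S f" "y \<in> S"
  shows "frechet_derivative (\<lambda>y. frechet_derivative f (at y) v) (at y) w
       = frechet_derivative (\<lambda>y. frechet_derivative f (at y) w) (at y) v"
proof (rule euclidean_eqI)
  fix b :: 'b
  have inner: "frechet_derivative (\<lambda>y. g y \<bullet> b) (at z) v = frechet_derivative g (at z) v \<bullet> b"
    if "smooth_on S g" "z \<in> S" for g :: "'a \<Rightarrow> 'b" and z v
    using frechet_derivative_eqI[OF has_derivative_inner_left[OF smooth_on_has_derivative[OF that]]] by metis
  have "frechet_derivative (\<lambda>y. frechet_derivative (\<lambda>y. f y \<bullet> b) (at y) v) (at y) w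
      = frechet_derivative (\<lambda>y. frechet_derivative f (at y) v) (at y) w \<bullet> b" for v w
  proof -
    have "smooth_on S (\<lambda>y. frechet_derivative (\<lambda>y. f y \<bullet> b) (at y) v)"
      using assms by (intro smooth_on_frechet_derivative smooth_on_inner_const)
    then have "frechet_derivative (\<lambda>y. frechet_derivative (\<lambda>y. f y \<bullet> b) (at y) v) (at y)
        = frechet_derivative (\<lambda>y. frechet_derivative f (at y) v \<bullet> b) (at y)"
      using inner[OF assms(2)] assms smooth_on_differentiable
      by (intro frechet_derivative_transform_within_open[of _ _ S]) auto
    then show ?thesis using inner[OF smooth_on_frechet_derivative[OF assms(2)] assms(3)] by simp
  qed
  then show "frechet_derivative (\<lambda>y. frechet_derivative f (at y) v) (at y) w \<bullet> b
       = frechet_derivative (\<lambda>y. frechet_derivative f (at y) w) (at y) v \<bullet> b"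
    using symmetric_second_derivative_real[OF assms(1) smooth_on_inner_const[OF assms(1,2)] assms(3)] by metis
qed

section \<open>Jacobi's formula for determinants\<close>

lemma det_replace_rows:
  fixes M C :: "real^'i^'i"
  shows "(\<Sum>i\<in>UNIV. det (\<chi> j. if j = i then (C ** M) $ i else M $ j)) = trace C * det M"
proof -
  \<comment> \<open>Row \<open>i\<close> of \<open>C ** M\<close> is a combination of the rows of
    \<open>M\<close>, of which only the multiple of row \<open>i\<close> itself survives in the
    determinant.\<close>
  have "det (\<chi> j. if j = i then (C ** M) $ i else M $ j) = C $ i $ i * det M" for i
  proof -
    have "(C ** M) $ i = (\<Sum>k\<in>UNIV. C $ i $ k *s row k M)"
      by (simp add: vec_eq_iff matrix_matrix_mult_def row_def sum_component)
    then have "(\<chi> j. if j = i then (C ** M) $ i else M $ j)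
        = (\<chi> j. if j = i then (\<Sum>k\<in>UNIV. (C $ i) $ k *s row k M) else row j M)"
      by (simp add: vec_eq_iff row_def)
    then show ?thesis by (simp only: cramer_lemma_transpose)
  qed
  then show ?thesis by (simp add: trace_def sum_distrib_right)
qed

text \<open>Product rule in each term of the permutation expansion; the terms in which the factor
  from row \<open>i\<close> is differentiated form the determinant with row \<open>i\<close>
  replaced.\<close>

lemma has_derivative_det:
  fixes M :: "'a::real_normed_vector \<Rightarrow> real^'i^'i"
  assumes "\<And>i j. ((\<lambda>y. M y $ i $ j) has_derivative (\<lambda>v. M' v $ i $ j)) (at y)"
  shows "((\<lambda>y. det (M y)) has_derivative
    (\<lambda>v. \<Sum>i\<in>UNIV. det (\<chi> j. if j = i then M' v $ i else M y $ j))) (at y)"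
proof -
  let ?p = "{p. p permutes (UNIV :: 'i set)}"
  have eq: "(\<Sum>i\<in>UNIV. det (\<chi> j. if j = i then M' v $ i else M y $ j))
    = (\<Sum>p\<in>?p. of_int (sign p) * (\<Sum>i\<in>UNIV. M' v $ i $ p i * (\<Prod>j\<in>UNIV - {i}. M y $ j $ p j)))" for v
  proof -
    have "(\<Prod>j\<in>UNIV. (\<chi> j. if j = i then M' v $ i else M y $ j) $ j $ p j)
      = M' v $ i $ p i * (\<Prod>j\<in>UNIV - {i}. M y $ j $ p j)" for i p
      by (simp add: prod.remove[of UNIV i])
    then show ?thesis unfolding det_def
      by (simp add: sum_distrib_left sum.swap[of _ ?p])
  qed
  show ?thesis unfolding eq unfolding det_def
    by (intro has_derivative_sum has_derivative_mult_right has_derivative_prod assms)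
qed

text \<open>Jacobi's formula for a derivative in factored form \<open>C v ** M y\<close>, which is
  how a connection matrix acts on the rows of a frame.\<close>

lemma has_derivative_det_trace:
  fixes M :: "'a::real_normed_vector \<Rightarrow> real^'i^'i"
  assumes "\<And>i j. ((\<lambda>y. M y $ i $ j) has_derivative (\<lambda>v. M' v $ i $ j)) (at y)"
    and "\<And>v. M' v = C v ** M y"
  shows "((\<lambda>y. det (M y)) has_derivative (\<lambda>v. trace (C v) * det (M y))) (at y)"
  using has_derivative_det[OF assms(1)] by (simp only: assms(2) det_replace_rows)

section \<open>Charts\<close>

lemma smooth_map_mono: "smooth_map A W f \<Longrightarrow> W' \<subseteq> W \<Longrightarrow> smooth_map A W' f"
  unfolding smooth_map_def by (fastforce intro: smooth_on_subset)

lemma smooth_field_mono: "smooth_field A W X \<Longrightarrow> W' \<subseteq> W \<Longrightarrow> smooth_field A W' X"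
  unfolding smooth_field_def by (fastforce intro: smooth_map_mono)

locale chart =
  fixes A :: "('m::{t2_space, second_countable_topology}, 'n::finite) chart set"
    and U :: "'m set" and \<phi> :: "'m \<Rightarrow> real^'n"
  assumes atlas: "smooth_atlas A" and chart_in: "(U, \<phi>) \<in> A"
begin

abbreviation \<psi> :: "real^'n \<Rightarrow> 'm" where "\<psi> \<equiv> inv_into U \<phi>"

text \<open>The coordinate field of the chart with constant components \<open>v\<close>, converted
  at each \<open>q\<close> to the preferred chart there. \<open>coord_field A p v\<close> is the
  case where the chart is the preferred one at \<open>p\<close>.\<close>

definition frame :: "real^'n \<Rightarrow> ('m, 'n) vfield" where
  "frame v q = frechet_derivative (snd (chart_at A q) \<circ> \<psi>) (at (\<phi> q)) v"

lemma homeo: "homeomorphism U (\<phi> ` U) \<phi> \<psi>" and open_dom: "open U" and open_img: "open (\<phi> ` U)"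
  using atlas chart_in unfolding smooth_atlas_def by auto

lemma inv_left: "q \<in> U \<Longrightarrow> \<psi> (\<phi> q) = q"
  and inv_right: "y \<in> \<phi> ` U \<Longrightarrow> \<phi> (\<psi> y) = y"
  and inv_in: "y \<in> \<phi> ` U \<Longrightarrow> \<psi> y \<in> U"
  using homeo unfolding homeomorphism_def by auto

lemma img_mem_iff: "W \<subseteq> U \<Longrightarrow> y \<in> \<phi> ` W \<longleftrightarrow> y \<in> \<phi> ` U \<and> \<psi> y \<in> W"
  using inv_left inv_right by force

lemma open_img_sub:
  assumes "open W" "W \<subseteq> U"
  shows "open (\<phi> ` W)"
proof -
  have "\<phi> ` W = \<phi> ` U \<inter> \<psi> -` W" using img_mem_iff[OF assms(2)] by auto
  moreover have "continuous_on (\<phi> ` U) \<psi>" using homeo unfolding homeomorphism_def by auto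
  ultimately show ?thesis using assms(1) open_img continuous_open_preimage by metis
qed

lemma chart_at_in: "chart_at A q \<in> A" "q \<in> fst (chart_at A q)"
proof -
  have "\<exists>c. c \<in> A \<and> q \<in> fst c" using atlas unfolding smooth_atlas_def by fastforce
  then have "chart_at A q \<in> A \<and> q \<in> fst (chart_at A q)" unfolding chart_at_def by (rule someI_ex)
  then show "chart_at A q \<in> A" "q \<in> fst (chart_at A q)" by auto
qed

lemma chart_at_chart: "chart A (fst (chart_at A q)) (snd (chart_at A q))"
  using atlas chart_at_in by unfold_locales auto

lemma smooth_mapD: "smooth_map A W f \<Longrightarrow> smooth_on (\<phi> ` (U \<inter> W)) (\<lambda>y. f (\<psi> y))"
  using chart_in unfolding smooth_map_def by (fastforce simp: o_def)

lemma smooth_transition: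
  assumes "(U', \<phi>') \<in> A"
  shows "smooth_on (\<phi> ` (U \<inter> U')) (\<lambda>y. \<phi>' (\<psi> y))"
  using atlas assms unfolding smooth_atlas_def by (fastforce intro: smooth_mapD)

text \<open>\<open>mdiff\<close> differentiates in the preferred chart, which changes with
  \<open>q\<close>. The passage to one fixed chart costs the Jacobian
  \<open>mdiff A \<phi> q\<close> of the transition map.\<close>

lemma mdiff_chain:
  assumes "q \<in> U" "(\<lambda>y. f (\<psi> y)) differentiable at (\<phi> q)"
  shows "mdiff A f q v = frechet_derivative (\<lambda>y. f (\<psi> y)) (at (\<phi> q)) (mdiff A \<phi> q v)"
    and "linear (mdiff A f q)"
proof -
  obtain U' \<phi>' where c: "chart_at A q = (U', \<phi>')" by fastforce
  interpret c: chart A U' \<phi>' using chart_at_chart[of q] c by simp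
  have q: "q \<in> U'" using chart_at_in(2)[of q] c by simp
  let ?S = "\<phi>' ` (U' \<inter> U)"
  have S: "open ?S" "\<phi>' q \<in> ?S" using c.open_img_sub open_dom c.open_dom q assms(1) by auto
  have mdiff: "mdiff A \<phi> q = frechet_derivative (\<lambda>y. \<phi> (c.\<psi> y)) (at (\<phi>' q))"
    by (simp add: fun_eq_iff mdiff_def c o_def)
  have t: "((\<lambda>y. \<phi> (c.\<psi> y)) has_derivative mdiff A \<phi> q) (at (\<phi>' q))"
    using smooth_on_has_derivative[OF c.smooth_transition[OF chart_in] S(2)] mdiff by simp
  have "((\<lambda>y. f (\<psi> y)) has_derivative frechet_derivative (\<lambda>y. f (\<psi> y)) (at (\<phi> q))) (at (\<phi> (c.\<psi> (\<phi>' q))))"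
    using assms(2) c.inv_left[OF q] by (simp add: frechet_derivative_works)
  from diff_chain_at[OF t this]
  have "((\<lambda>y. f (\<psi> (\<phi> (c.\<psi> y)))) has_derivative
      (\<lambda>v. frechet_derivative (\<lambda>y. f (\<psi> y)) (at (\<phi> q)) (mdiff A \<phi> q v))) (at (\<phi>' q))"
    by (simp add: o_def)
  then have D: "((\<lambda>y. f (c.\<psi> y)) has_derivative
      (\<lambda>v. frechet_derivative (\<lambda>y. f (\<psi> y)) (at (\<phi> q)) (mdiff A \<phi> q v))) (at (\<phi>' q))"
    by (rule has_derivative_transform_within_open[OF _ S])
      (use c.img_mem_iff[of "U' \<inter> U"] inv_left in auto)
  then have eq: "mdiff A f q = (\<lambda>v. frechet_derivative (\<lambda>y. f (\<psi> y)) (at (\<phi> q)) (mdiff A \<phi> q v))"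
    by (simp add: mdiff_def c o_def frechet_derivative_eqI fun_eq_iff)
  then show "mdiff A f q v = frechet_derivative (\<lambda>y. f (\<psi> y)) (at (\<phi> q)) (mdiff A \<phi> q v)" by simp
  show "linear (mdiff A f q)" using has_derivative_linear[OF D] unfolding eq .
qed

lemma smooth_map_has_derivative:
  assumes "smooth_map A W f" "q \<in> U" "q \<in> W"
  shows "((\<lambda>y. f (\<psi> y)) has_derivative frechet_derivative (\<lambda>y. f (\<psi> y)) (at (\<phi> q))) (at (\<phi> q))"
  using smooth_on_has_derivative[OF smooth_mapD[OF assms(1)]] assms by blast

lemma smooth_map_differentiable:
  assumes "smooth_map A W f" "q \<in> U" "q \<in> W"
  shows "(\<lambda>y. f (\<psi> y)) differentiable at (\<phi> q)"
  using smooth_map_has_derivative[OF assms] differentiableI by blast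

lemma mdiff_smooth_map:
  assumes "smooth_map A W f" "q \<in> U" "q \<in> W"
  shows "mdiff A f q v = frechet_derivative (\<lambda>y. f (\<psi> y)) (at (\<phi> q)) (mdiff A \<phi> q v)"
  by (rule mdiff_chain(1)[OF assms(2) smooth_map_differentiable[OF assms]])

lemma linear_mdiff:
  assumes "smooth_map A W f" "q \<in> W"
  shows "linear (mdiff A f q)"
proof -
  interpret c: chart A "fst (chart_at A q)" "snd (chart_at A q)" by (rule chart_at_chart)
  show ?thesis
    using c.mdiff_chain(2)[OF chart_at_in(2) c.smooth_map_differentiable[OF assms(1) chart_at_in(2) assms(2)]] .
qed

lemma smooth_map_chart: "smooth_map A U \<phi>"
  using atlas chart_in unfolding smooth_atlas_def by blast

lemma linear_mdiff_chart: "q \<in> U \<Longrightarrow> linear (mdiff A \<phi> q)"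
  by (rule linear_mdiff[OF smooth_map_chart])

text \<open>\<open>frame\<close> and \<open>mdiff A \<phi> q\<close> are the derivatives of the two
  mutually inverse transition maps between \<open>\<phi>\<close> and the preferred chart at
  \<open>q\<close>, so the chain rule makes them inverse to each other.\<close>

lemma frame_inverse:
  assumes "q \<in> U"
  shows "mdiff A \<phi> q (frame v q) = v" and "frame (mdiff A \<phi> q w) q = w" and "linear (\<lambda>v. frame v q)"
proof -
  obtain U' \<phi>' where c: "chart_at A q = (U', \<phi>')" by fastforce
  interpret c: chart A U' \<phi>' using chart_at_chart[of q] c by simp
  have q: "q \<in> U'" using chart_at_in(2)[of q] c by simp
  let ?S = "\<phi>' ` (U' \<inter> U)" and ?R = "\<phi> ` (U \<inter> U')"
  have S: "open ?S" "\<phi>' q \<in> ?S" "open ?R" "\<phi> q \<in> ?R"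
    by (intro c.open_img_sub open_img_sub open_Int imageI IntI open_dom c.open_dom q assms(1) Int_lower1)+
  have mdiff: "mdiff A \<phi> q = frechet_derivative (\<lambda>y. \<phi> (c.\<psi> y)) (at (\<phi>' q))"
    by (simp add: fun_eq_iff mdiff_def c o_def)
  have d1: "((\<lambda>y. \<phi> (c.\<psi> y)) has_derivative mdiff A \<phi> q) (at (\<phi>' q))"
    using smooth_on_has_derivative[OF c.smooth_transition[OF chart_in] S(2)] mdiff by simp
  have d2: "((\<lambda>y. \<phi>' (\<psi> y)) has_derivative (\<lambda>v. frame v q)) (at (\<phi> q))"
    using smooth_on_has_derivative[OF smooth_transition[OF c.chart_in] S(4)]
    by (simp add: frame_def c o_def)
  show "linear (\<lambda>v. frame v q)" by (rule has_derivative_linear[OF d2])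
  have "((\<lambda>y. \<phi> (c.\<psi> (\<phi>' (\<psi> y)))) has_derivative (\<lambda>v. mdiff A \<phi> q (frame v q))) (at (\<phi> q))"
    using diff_chain_at[OF d2, of "\<lambda>y. \<phi> (c.\<psi> y)" "mdiff A \<phi> q"] d1 inv_left[OF assms] by (simp add: o_def)
  then have "((\<lambda>y. y) has_derivative (\<lambda>v. mdiff A \<phi> q (frame v q))) (at (\<phi> q))"
    by (rule has_derivative_transform_within_open[OF _ S(3,4)])
      (use img_mem_iff[of "U \<inter> U'"] inv_left c.inv_left in auto)
  then show "mdiff A \<phi> q (frame v q) = v"
    using has_derivative_ident has_derivative_unique by metis
  have "((\<lambda>y. \<phi>' (\<psi> (\<phi> (c.\<psi> y)))) has_derivative (\<lambda>v. frame (mdiff A \<phi> q v) q)) (at (\<phi>' q))"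
    using diff_chain_at[OF d1, of "\<lambda>y. \<phi>' (\<psi> y)" "\<lambda>v. frame v q"] d2 c.inv_left[OF q] by (simp add: o_def)
  then have "((\<lambda>y. y) has_derivative (\<lambda>v. frame (mdiff A \<phi> q v) q)) (at (\<phi>' q))"
    by (rule has_derivative_transform_within_open[OF _ S(1,2)])
      (use c.img_mem_iff[of "U' \<inter> U"] inv_left c.inv_left in auto)
  then show "frame (mdiff A \<phi> q w) q = w"
    using has_derivative_ident has_derivative_unique by metis
qed

lemma mdiff_frame:
  assumes "smooth_map A W f" "q \<in> U" "q \<in> W"
  shows "mdiff A f q (frame v q) = frechet_derivative (\<lambda>y. f (\<psi> y)) (at (\<phi> q)) v"
  using mdiff_smooth_map[OF assms] frame_inverse(1)[OF assms(2)] by metis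

lemma smooth_map_chartI:
  assumes "open W" "W \<subseteq> U" "smooth_on (\<phi> ` W) (\<lambda>y. f (\<psi> y))"
  shows "smooth_map A W f"
  unfolding smooth_map_def
proof clarify
  fix U' \<phi>' assume "(U', \<phi>') \<in> A"
  then interpret c: chart A U' \<phi>' using atlas by unfold_locales
  let ?S = "\<phi>' ` (U' \<inter> W)"
  have S: "open ?S" using c.open_img_sub c.open_dom assms(1) by auto
  have "smooth_on ?S (\<lambda>y. \<phi> (c.\<psi> y))"
    by (rule smooth_on_subset[OF c.smooth_transition[OF chart_in]]) (use assms(2) in auto)
  then have "smooth_on ?S (\<lambda>y. f (\<psi> (\<phi> (c.\<psi> y))))"
    using c.inv_left by (intro smooth_on_compose[OF S open_img_sub[OF assms(1,2)] _ _ assms(3)]) auto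
  moreover have "f (\<psi> (\<phi> (c.\<psi> y))) = (f \<circ> c.\<psi>) y" if "y \<in> ?S" for y
    using that assms(2) c.inv_left inv_left by auto
  ultimately show "smooth_on ?S (f \<circ> c.\<psi>)" by (rule smooth_on_transform[OF S])
qed

lemma smooth_fieldD:
  assumes "smooth_field A W X"
  shows "smooth_on (\<phi> ` (U \<inter> W)) (\<lambda>y. mdiff A \<phi> (\<psi> y) (X (\<psi> y)))"
proof -
  have "smooth_map A (U \<inter> W) (deriv_along A X \<phi>)"
    using assms chart_in unfolding smooth_field_def by blast
  from smooth_mapD[OF this] show ?thesis by (simp add: Int_absorb1)
qed

lemma smooth_on_deriv_along:
  assumes "open W" "smooth_map A W f" "smooth_on (\<phi> ` (U \<inter> W)) (\<lambda>y. mdiff A \<phi> (\<psi> y) (X (\<psi> y)))"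
  shows "smooth_on (\<phi> ` (U \<inter> W)) (\<lambda>y. mdiff A f (\<psi> y) (X (\<psi> y)))"
    and "y \<in> \<phi> ` (U \<inter> W) \<Longrightarrow> mdiff A f (\<psi> y) (X (\<psi> y)) =
      frechet_derivative (\<lambda>y. f (\<psi> y)) (at y) (mdiff A \<phi> (\<psi> y) (X (\<psi> y)))"
proof -
  have S: "open (\<phi> ` (U \<inter> W))" using open_img_sub open_dom assms(1) by auto
  show eq: "mdiff A f (\<psi> y) (X (\<psi> y)) =
      frechet_derivative (\<lambda>y. f (\<psi> y)) (at y) (mdiff A \<phi> (\<psi> y) (X (\<psi> y)))"
    if "y \<in> \<phi> ` (U \<inter> W)" for y
    using mdiff_smooth_map[OF assms(2), of "\<psi> y"] that inv_left inv_right by auto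
  show "smooth_on (\<phi> ` (U \<inter> W)) (\<lambda>y. mdiff A f (\<psi> y) (X (\<psi> y)))"
    by (rule smooth_on_transform[OF S smooth_on_derivative_along[OF S smooth_mapD[OF assms(2)] assms(3)]])
      (rule eq[symmetric])
qed

text \<open>Components in another chart are the derivatives of its coordinate map along
  \<open>X\<close>, so one chart containing \<open>W\<close> decides smoothness in all of
  them.\<close>

lemma smooth_fieldI:
  assumes "open W" "W \<subseteq> U" "smooth_on (\<phi> ` W) (\<lambda>y. mdiff A \<phi> (\<psi> y) (X (\<psi> y)))"
  shows "smooth_field A W X"
  unfolding smooth_field_def
proof clarify
  fix U' \<phi>' assume "(U', \<phi>') \<in> A"
  then interpret c: chart A U' \<phi>' using atlas by unfold_locales
  have U: "U \<inter> (U' \<inter> W) = U' \<inter> W" using assms(2) by blast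
  have "smooth_on (\<phi> ` (U \<inter> (U' \<inter> W))) (\<lambda>y. mdiff A \<phi>' (\<psi> y) (X (\<psi> y)))"
    by (rule smooth_on_deriv_along(1)[OF open_Int[OF c.open_dom assms(1)]
          smooth_map_mono[OF c.smooth_map_chart] smooth_on_subset[OF assms(3)]]) auto
  then show "smooth_map A (U' \<inter> W) (deriv_along A X \<phi>')"
    unfolding U using assms c.open_dom by (intro smooth_map_chartI) auto
qed

lemma smooth_field_frame: "smooth_field A U (frame v)"
proof -
  have "smooth_on (\<phi> ` U) (\<lambda>y. mdiff A \<phi> (\<psi> y) (frame v (\<psi> y)))"
    by (rule smooth_on_transform[OF open_img smooth_on_const[of _ v]]) (simp add: frame_inverse(1) inv_in)
  then show ?thesis by (intro smooth_fieldI) (auto simp: open_dom)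
qed

text \<open>The first summand is the coordinate Hessian of \<open>f\<close>, the second carries the
  derivative of the components of \<open>Y\<close>. In a commutator the Hessians cancel.\<close>

lemma mdiff_deriv_along:
  assumes "open W" "smooth_map A W f" "smooth_field A W Y" "q \<in> U" "q \<in> W"
  shows "mdiff A (deriv_along A Y f) q v =
    frechet_derivative (\<lambda>y. frechet_derivative (\<lambda>y. f (\<psi> y)) (at y) (mdiff A \<phi> q (Y q))) (at (\<phi> q)) (mdiff A \<phi> q v)
    + frechet_derivative (\<lambda>y. f (\<psi> y)) (at (\<phi> q))
        (frechet_derivative (\<lambda>y. mdiff A \<phi> (\<psi> y) (Y (\<psi> y))) (at (\<phi> q)) (mdiff A \<phi> q v))"
proof -
  let ?S = "\<phi> ` (U \<inter> W)" and ?F = "\<lambda>y. f (\<psi> y)" and ?\<eta> = "\<lambda>y. mdiff A \<phi> (\<psi> y) (Y (\<psi> y))"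
  have S: "open ?S" "\<phi> q \<in> ?S" using open_img_sub open_dom assms by auto
  note \<eta> = smooth_fieldD[OF assms(3)] and F = smooth_mapD[OF assms(2)]
  have d: "(\<lambda>y. deriv_along A Y f (\<psi> y)) differentiable at (\<phi> q)"
    by (rule smooth_on_differentiable[OF smooth_on_deriv_along(1)[OF assms(1,2) \<eta>] S(2)])
  have "mdiff A (deriv_along A Y f) q v
      = frechet_derivative (\<lambda>y. deriv_along A Y f (\<psi> y)) (at (\<phi> q)) (mdiff A \<phi> q v)"
    by (rule mdiff_chain(1)[OF assms(4) d])
  also have "frechet_derivative (\<lambda>y. deriv_along A Y f (\<psi> y)) (at (\<phi> q))
      = frechet_derivative (\<lambda>y. frechet_derivative ?F (at y) (?\<eta> y)) (at (\<phi> q))"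
    by (rule frechet_derivative_transform_within_open[OF d S]) (rule smooth_on_deriv_along(2)[OF assms(1,2) \<eta>])
  finally show ?thesis
    using frechet_derivative_along[OF S(1) F \<eta> S(2)] inv_left[OF assms(4)] by simp
qed

lemma smooth_map_deriv_along:
  assumes "open W" "smooth_map A W f" "smooth_field A W X"
  shows "smooth_map A W (deriv_along A X f)"
  unfolding smooth_map_def
proof clarify
  fix U' \<phi>' assume "(U', \<phi>') \<in> A"
  then interpret c: chart A U' \<phi>' using atlas by unfold_locales
  show "smooth_on (\<phi>' ` (U' \<inter> W)) (deriv_along A X f \<circ> c.\<psi>)"
    using c.smooth_on_deriv_along(1)[OF assms(1,2) c.smooth_fieldD[OF assms(3)]] by (simp add: o_def)
qed

lemma smooth_field_UNIVI:
  assumes "\<And>U \<phi>. (U, \<phi>) \<in> A \<Longrightarrow> smooth_on (\<phi> ` U) (\<lambda>y. mdiff A \<phi> (inv_into U \<phi> y) (X (inv_into U \<phi> y)))"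
  shows "smooth_field A UNIV X"
  unfolding smooth_field_def
proof clarify
  fix U' \<phi>' assume *: "(U', \<phi>') \<in> A"
  then interpret c: chart A U' \<phi>' using atlas by unfold_locales
  show "smooth_map A (U' \<inter> UNIV) (deriv_along A X \<phi>')"
    using assms[OF *] by (intro c.smooth_map_chartI) (auto simp: c.open_dom)
qed

end

lemma chart_chart_at:
  assumes "smooth_atlas A"
  shows "chart A (fst (chart_at A q)) (snd (chart_at A q))" and "q \<in> fst (chart_at A q)"
proof -
  obtain U \<phi> where "(U, \<phi>) \<in> A" using assms unfolding smooth_atlas_def by fastforce
  then interpret chart A U \<phi> using assms by unfold_locales
  show "chart A (fst (chart_at A q)) (snd (chart_at A q))" "q \<in> fst (chart_at A q)"
    using chart_at_chart chart_at_in by auto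
qed

text \<open>Tensorial identities at \<open>p\<close> are computed in this setting: at
  \<open>p\<close> itself, tangent vectors coincide with chart components
  (\<open>mdiff_self\<close>, \<open>frame_self\<close>).\<close>

locale preferred_chart = chart +
  fixes p
  assumes preferred: "chart_at A p = (U, \<phi>)"
begin

lemma p_in: "p \<in> U" using chart_at_in(2)[of p] preferred by simp

lemma coord_field_eq: "coord_field A p v = frame v"
  by (simp add: fun_eq_iff coord_field_def frame_def preferred)

lemma mdiff_self: "mdiff A \<phi> p v = v"
proof -
  have "((\<lambda>y. y) has_derivative (\<lambda>v. v)) (at (\<phi> p))" by simp
  then have "((\<lambda>y. \<phi> (\<psi> y)) has_derivative (\<lambda>v. v)) (at (\<phi> p))"
    by (rule has_derivative_transform_within_open[OF _ open_img]) (use p_in inv_right in auto)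
  then show ?thesis by (simp add: mdiff_def preferred o_def frechet_derivative_eqI)
qed

lemma frame_self: "frame v p = v"
  using frame_inverse(2)[OF p_in] mdiff_self by metis

end

lemma preferred_chart_at:
  assumes "smooth_atlas A"
  shows "preferred_chart A (fst (chart_at A p)) (snd (chart_at A p)) p"
  using chart_chart_at[OF assms] by (auto simp: preferred_chart_def preferred_chart_axioms_def)

text \<open>Symmetry of second derivatives removes the Hessians, and what remains is the derivative
  of \<open>f\<close> applied to the bracket components. For real \<open>f\<close> this makes
  \<open>d (d f)\<close> vanish.\<close>

lemma mdiff_lie_bracket:
  fixes f :: "'m::{t2_space, second_countable_topology} \<Rightarrow> 'b::euclidean_space"
    and A :: "('m, 'n::finite) chart set"
  assumes "smooth_atlas A" "open W" "smooth_map A W f" "smooth_field A W X" "smooth_field A W Y" "p \<in> W"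
  shows "mdiff A f p (lie_bracket A X Y p) =
    deriv_along A X (deriv_along A Y f) p - deriv_along A Y (deriv_along A X f) p"
proof -
  obtain U \<phi> where c: "chart_at A p = (U, \<phi>)" by fastforce
  interpret preferred_chart A U \<phi> p using preferred_chart_at[OF assms(1), of p] c by simp
  note f = smooth_mapD[OF assms(3)]
  have p: "\<phi> p \<in> \<phi> ` (U \<inter> W)" using p_in assms(6) by blast
  have S: "open (\<phi> ` (U \<inter> W))" using open_img_sub open_dom assms(2) by auto
  have d: "mdiff A (deriv_along A Z \<phi>) p v = frechet_derivative (\<lambda>y. mdiff A \<phi> (\<psi> y) (Z (\<psi> y))) (at (\<phi> p)) v"
    if "smooth_field A W Z" for Z v
    using mdiff_chain(1)[OF p_in smooth_on_differentiable[OF smooth_fieldD[OF that] p]] by (simp add: mdiff_self)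
  have lin: "linear (frechet_derivative (\<lambda>y. f (\<psi> y)) (at (\<phi> p)))"
    by (rule smooth_on_linear_derivative[OF f p])
  show ?thesis
    using symmetric_second_derivative[OF S f p, of "X p" "Y p"]
    by (simp add: mdiff_deriv_along[OF assms(2,3,4) p_in assms(6)] mdiff_deriv_along[OF assms(2,3,5) p_in assms(6)]
        mdiff_self mdiff_smooth_map[OF assms(3) p_in assms(6)] lie_bracket_def c d[OF assms(4)] d[OF assms(5)]
        linear_diff[OF lin])
qed

section \<open>Block matrices\<close>

lemma sum_UNIV_option:
  fixes f :: "'n::finite option \<Rightarrow> 'b::comm_monoid_add"
  shows "(\<Sum>a\<in>UNIV. f a) = f None + (\<Sum>i\<in>UNIV. f (Some i))"
proof -
  have "(\<Sum>a\<in>UNIV. f a) = f None + (\<Sum>a\<in>range Some. f a)"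
    unfolding UNIV_option_conv by (rule sum.insert) auto
  then show ?thesis by (simp add: sum.reindex)
qed

text \<open>Corner \<open>1\<close> occurs for frame changes, which fix the transversal direction,
  and for Gram matrices; corner \<open>0\<close> for the connection matrices that arise by
  differentiation.\<close>

definition block :: "real \<Rightarrow> real^'n::finite^'n \<Rightarrow> real^('n option)^('n option)" where
  "block c M = (\<chi> a b. case a of
      None \<Rightarrow> (case b of None \<Rightarrow> c | Some j \<Rightarrow> 0)
    | Some i \<Rightarrow> (case b of None \<Rightarrow> 0 | Some j \<Rightarrow> M $ i $ j))"

lemma block_nth [simp]:
  "block c M $ None $ None = c" "block c M $ None $ Some j = 0"
  "block c M $ Some i $ None = 0" "block c M $ Some i $ Some j = M $ i $ j"
  by (simp_all add: block_def)

lemma option_mat_eqI: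
  fixes M N :: "real^('n::finite option)^('n option)"
  assumes "M $ None $ None = N $ None $ None" "\<And>j. M $ None $ Some j = N $ None $ Some j"
    "\<And>i. M $ Some i $ None = N $ Some i $ None" "\<And>i j. M $ Some i $ Some j = N $ Some i $ Some j"
  shows "M = N"
  unfolding vec_eq_iff by (metis assms not_None_eq)

lemma block_mult: "block c M ** block d N = block (c * d) (M ** N)"
  by (rule option_mat_eqI) (simp_all add: matrix_matrix_mult_def sum_UNIV_option)

lemma block_add: "block c M + block d N = block (c + d) (M + N)"
  by (rule option_mat_eqI) simp_all

lemma transpose_block: "transpose (block c M) = block c (transpose M)"
  by (rule option_mat_eqI) (simp_all add: transpose_def)

lemma trace_block: "trace (block c M) = c + trace M"
  by (simp add: trace_def sum_UNIV_option)

lemma det_block_nonzero: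
  fixes M :: "real^'n::finite^'n"
  assumes "det M \<noteq> 0"
  shows "det (block 1 M) \<noteq> 0"
proof -
  obtain N where "M ** N = mat 1" using assms invertible_det_nz invertible_def by metis
  moreover have "block 1 (mat 1 :: real^'n^'n) = mat 1"
    by (rule option_mat_eqI) (simp_all add: mat_def)
  ultimately have "block 1 M ** block 1 N = mat 1" by (simp add: block_mult)
  then show ?thesis by (metis det_I det_mul mult_zero_left zero_neq_one)
qed

lemma vec_axis_expand: "(v::real^'n::finite) = (\<Sum>i\<in>UNIV. v $ i *\<^sub>R axis i 1)"
  by (simp add: vec_eq_iff axis_def if_distrib cong: if_cong)

lemma linear_axis_expand:
  fixes L :: "real^'n::finite \<Rightarrow> 'b::real_vector"
  assumes "linear L"
  shows "L v = (\<Sum>i\<in>UNIV. v $ i *\<^sub>R L (axis i 1))"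
  by (subst vec_axis_expand) (simp add: linear_sum[OF assms] linear_scale[OF assms])

lemma transpose_mult_nth:
  fixes M :: "real^'i^'j"
  shows "(transpose M *v c) $ b = (\<Sum>a\<in>UNIV. c $ a * M $ a $ b)"
  by (simp add: matrix_vector_mult_def transpose_def mult.commute)

lemma det_nonzeroI:
  fixes M :: "real^'i^'i"
  assumes "\<And>c. M *v c = 0 \<Longrightarrow> c = 0"
  shows "det M \<noteq> 0"
  using assms invertible_det_nz invertible_left_inverse matrix_left_invertible_ker by metis

section \<open>Centroaffine hypersurfaces\<close>

locale centroaffine =
  fixes A :: "('m::{t2_space, second_countable_topology}, 'n::finite) chart set"
    and x :: "'m \<Rightarrow> real^'k::finite"
    and eps :: real
    and nab nabh :: "('m, 'n) conn"
    and h :: "('m, 'n) two_tensor"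
  assumes hyp: "centroaffine_hypersurface A x"
    and eps: "eps \<in> {1, -1}"
    and dec: "centroaffine_decomposition A x eps nab h"
    and pd: "positive_definite h"
    and lc: "levi_civita A h nabh"
begin

lemma smooth_atlas: "smooth_atlas A" and smooth_x: "smooth_map A UNIV x"
  and inj_x: "inj (mdiff A x p)" and transversal: "x p \<notin> range (mdiff A x p)"
  and cards: "CARD('k) = CARD('n) + 1"
  using hyp unfolding centroaffine_hypersurface_def by auto

lemma eps_sq: "eps * eps = 1" using eps by auto

lemma linear_x: "linear (mdiff A x p)"
  using chart.linear_mdiff[OF chart_chart_at(1)[OF smooth_atlas] smooth_x] by simp

lemma tangent_zero: "mdiff A x q a = 0 \<Longrightarrow> a = 0"
  using inj_x[of q] linear_x[of q] linear_injective_0 by blast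

lemma transversal_zero:
  assumes "mdiff A x q a + s *\<^sub>R x q = 0"
  shows "a = 0 \<and> s = 0"
proof -
  have "s = 0"
  proof (rule ccontr)
    assume "s \<noteq> 0"
    have "mdiff A x q ((- 1 / s) *\<^sub>R a) = (- 1 / s) *\<^sub>R mdiff A x q a"
      by (rule linear_scale[OF linear_x])
    also have "mdiff A x q a = - (s *\<^sub>R x q)" using assms by (simp add: eq_neg_iff_add_eq_0)
    finally have "x q = mdiff A x q ((- 1 / s) *\<^sub>R a)" using \<open>s \<noteq> 0\<close> by simp
    then show False using transversal[of q] by (metis rangeI)
  qed
  then show ?thesis using assms tangent_zero by simp
qed

lemma transversal_unique:
  assumes "mdiff A x q a + s *\<^sub>R x q = mdiff A x q b + t *\<^sub>R x q"
  shows "a = b" and "s = t"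
proof -
  have "mdiff A x q (a - b) + (s - t) *\<^sub>R x q = 0"
    using assms by (simp add: linear_diff[OF linear_x] algebra_simps)
  then show "a = b" "s = t" using transversal_zero by (metis eq_iff_diff_eq_0)+
qed

text \<open>Both matrices are made square by an extra index \<open>None\<close> for the transversal direction \<open>x\<close>,
  so that their determinants scale by the same power under a change of frame.\<close>

definition cols :: "'n option \<Rightarrow> 'k" where "cols = (SOME g. bij g)"

lemma bij_cols: "bij cols"
proof -
  have "CARD('n option) = CARD('k)" using cards by simp
  then have "\<exists>g :: 'n option \<Rightarrow> 'k. bij g" by (intro finite_same_card_bij) auto
  then show ?thesis unfolding cols_def by (rule someI_ex)
qed

definition frame_row :: "'m \<Rightarrow> ('n \<Rightarrow> real^'n) \<Rightarrow> 'n option \<Rightarrow> real^'k" where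
  "frame_row q E a = (case a of None \<Rightarrow> x q | Some i \<Rightarrow> mdiff A x q (E i))"

text \<open>Its determinant is \<open>\<theta>\<close> evaluated on \<open>E\<close>, up to a sign
  that depends on \<open>cols\<close> and the ordering of the indices.\<close>

definition Bmat :: "'m \<Rightarrow> ('n \<Rightarrow> real^'n) \<Rightarrow> real^('n option)^('n option)" where
  "Bmat q E = (\<chi> a b. frame_row q E a $ cols b)"

definition Gram :: "'m \<Rightarrow> ('n \<Rightarrow> real^'n) \<Rightarrow> real^'n^'n" where
  "Gram q E = (\<chi> i j. h q (E i) (E j))"

text \<open>A dictionary between combinations of the rows of \<open>Bmat\<close> and sums of a
  tangent vector and a multiple of \<open>x\<close>, used wherever a matrix identity has to be read
  as a vector identity.\<close>

lemma Bmat_combination: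
  "(\<Sum>a\<in>UNIV. c a * Bmat q E $ a $ b)
    = (mdiff A x q (\<Sum>i\<in>UNIV. c (Some i) *\<^sub>R E i) + c None *\<^sub>R x q) $ cols b"
  by (simp add: sum_UNIV_option Bmat_def frame_row_def linear_sum[OF linear_x] linear_scale[OF linear_x] sum_component)

text \<open>A vanishing combination of rows is a vanishing sum of a tangent vector and a multiple of
  \<open>x\<close>, so transversality and immersion force zero coefficients. Frames are images of
  the standard basis under an injective \<open>L\<close>, which covers preferred bases and
  coordinate frames alike.\<close>

lemma det_Bmat_nonzero:
  fixes L :: "real^'n \<Rightarrow> real^'n"
  assumes "linear L" "\<And>v. L v = 0 \<Longrightarrow> v = 0"
  shows "det (Bmat q (\<lambda>i. L (axis i 1))) \<noteq> 0"
proof -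
  let ?E = "\<lambda>i. L (axis i 1)"
  have "det (transpose (Bmat q ?E)) \<noteq> 0"
  proof (rule det_nonzeroI)
    fix c :: "real^'n option" assume c: "transpose (Bmat q ?E) *v c = 0"
    let ?u = "mdiff A x q (\<Sum>i\<in>UNIV. c $ Some i *\<^sub>R ?E i) + c $ None *\<^sub>R x q"
    have u: "?u $ cols b = 0" for b
      using c Bmat_combination[of "\<lambda>a. c $ a" q ?E b]
      by (simp add: vec_eq_iff matrix_vector_mult_def transpose_def mult.commute)
    have "?u $ k = 0" for k
    proof -
      obtain b where "k = cols b" using surjD[OF bij_is_surj[OF bij_cols]] by blast
      with u[of b] show ?thesis by (simp only:)
    qed
    then have "?u = 0" by (simp only: vec_eq_iff zero_index simp_thms)
    then have "(\<Sum>i\<in>UNIV. c $ Some i *\<^sub>R ?E i) = 0" "c $ None = 0" using transversal_zero by blast+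
    moreover have "L (\<chi> i. c $ Some i) = (\<Sum>i\<in>UNIV. c $ Some i *\<^sub>R ?E i)"
      using linear_axis_expand[OF assms(1), of "\<chi> i. c $ Some i"] by simp
    ultimately have c0: "(\<chi> i. c $ Some i) = 0" "c $ None = 0" using assms(2) by metis+
    have "c $ a = 0" for a
      by (cases a) (use c0 in \<open>simp_all add: vec_eq_iff\<close>)
    then show "c = 0" by (simp add: vec_eq_iff)
  qed
  then show ?thesis by (simp add: det_transpose)
qed

end

section \<open>Gauss formula in a chart and smoothness of the metric\<close>

locale centroaffine_chart = centroaffine A x eps nab nabh h + chart A U \<phi>
  for A :: "('m::{t2_space, second_countable_topology}, 'n::finite) chart set"
    and x :: "'m \<Rightarrow> real^'k::finite"
    and eps nab nabh h U \<phi>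
begin

abbreviation f :: "real^'n \<Rightarrow> real^'k" where "f y \<equiv> x (\<psi> y)"

definition second_deriv :: "real^'n \<Rightarrow> real^'n \<Rightarrow> real^'n \<Rightarrow> real^'k" where
  "second_deriv y v w = frechet_derivative (\<lambda>z. frechet_derivative f (at z) w) (at y) v"

lemma smooth_f: "smooth_on (\<phi> ` U) f"
  using smooth_mapD[OF smooth_x] by simp

lemma smooth_second_deriv: "smooth_on (\<phi> ` U) (\<lambda>y. second_deriv y v w)"
  unfolding second_deriv_def by (intro smooth_on_frechet_derivative smooth_f)

lemma second_deriv_sym: "q \<in> U \<Longrightarrow> second_deriv (\<phi> q) v w = second_deriv (\<phi> q) w v"
  unfolding second_deriv_def by (rule symmetric_second_derivative[OF open_img smooth_f]) simp

lemma second_deriv_linear: "q \<in> U \<Longrightarrow> linear (\<lambda>v. second_deriv (\<phi> q) v w)"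
  unfolding second_deriv_def
  by (rule smooth_on_linear_derivative[OF smooth_on_frechet_derivative[OF smooth_f]]) simp

text \<open>Coordinate fields have constant components in their own chart, so differentiating
  \<open>x\<close> twice along them leaves the plain second derivative of its coordinate
  expression.\<close>

lemma structure_equation:
  assumes "q \<in> U"
  shows "second_deriv (\<phi> q) v w = mdiff A x q (nab (frame v) (frame w) q)
    + (- eps * h q (frame v q) (frame w q)) *\<^sub>R x q"
proof -
  have "mdiff A (deriv_along A (frame w) x) q (frame v q)
    = mdiff A x q (nab (frame v) (frame w) q) + h q (frame v q) (frame w q) *\<^sub>R (- eps *\<^sub>R x q)"
    using dec smooth_field_frame open_dom assms unfolding centroaffine_decomposition_def by blast
  moreover have "frechet_derivative (\<lambda>y. mdiff A \<phi> (\<psi> y) (frame w (\<psi> y))) (at (\<phi> q)) v = 0"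
  proof -
    have "((\<lambda>y. w) has_derivative (\<lambda>v. 0)) (at (\<phi> q))" by simp
    then have "((\<lambda>y. mdiff A \<phi> (\<psi> y) (frame w (\<psi> y))) has_derivative (\<lambda>v. 0)) (at (\<phi> q))"
      by (rule has_derivative_transform_within_open[OF _ open_img])
        (use assms frame_inverse(1) inv_in in auto)
    then show ?thesis by (simp add: frechet_derivative_eqI)
  qed
  moreover have "linear (frechet_derivative f (at (\<phi> q)))"
    by (rule smooth_on_linear_derivative[OF smooth_f]) (use assms in simp)
  ultimately show ?thesis
    using mdiff_deriv_along[OF open_dom smooth_map_mono[OF smooth_x] smooth_field_frame assms assms, of w "frame v q"]
    by (simp add: frame_inverse(1)[OF assms] second_deriv_def linear_0 mult.commute)
qed

lemma frame_row_coordinates: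
  assumes "q \<in> U"
  shows "frame_row q (\<lambda>i. frame (axis i 1) q) a =
    (case a of None \<Rightarrow> f (\<phi> q) | Some i \<Rightarrow> frechet_derivative f (at (\<phi> q)) (axis i 1))"
  using mdiff_frame[OF smooth_x assms] inv_left[OF assms] by (simp add: frame_row_def split: option.split)

lemma smooth_Bmat:
  "smooth_on (\<phi> ` U) (\<lambda>y. Bmat (\<psi> y) (\<lambda>i. frame (axis i 1) (\<psi> y)) $ a $ b)"
proof -
  have "smooth_on (\<phi> ` U) (\<lambda>y. (case a of None \<Rightarrow> f y | Some i \<Rightarrow> frechet_derivative f (at y) (axis i 1)) $ cols b)"
    by (cases a) (auto intro!: smooth_on_vec_nth open_img smooth_f smooth_on_frechet_derivative)
  then show ?thesis
    by (rule smooth_on_transform[OF open_img]) (use frame_row_coordinates inv_left in \<open>auto simp: Bmat_def\<close>)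
qed

lemma det_Bmat_frame: "q \<in> U \<Longrightarrow> det (Bmat q (\<lambda>i. frame (axis i 1) q)) \<noteq> 0"
  using frame_inverse linear_0[OF linear_mdiff_chart] by (intro det_Bmat_nonzero) metis+

text \<open>By the Gauss formula, \<open>- eps * h\<close> is the coefficient of \<open>x\<close>
  when a second derivative of \<open>x\<close> is expanded in the rows of \<open>Bmat\<close>.
  Cramer's rule gives it as a quotient of determinants with smooth entries.\<close>

lemma smooth_h: "smooth_on (\<phi> ` U) (\<lambda>y. h (\<psi> y) (frame v (\<psi> y)) (frame w (\<psi> y)))"
proof -
  let ?B = "\<lambda>y. Bmat (\<psi> y) (\<lambda>i. frame (axis i 1) (\<psi> y))"
  \<comment> \<open>Numerator of Cramer's rule: column \<open>None\<close>, which belongs to the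
    unknown \<open>- eps * h\<close>, is replaced by the right-hand side.\<close>
  let ?C = "\<lambda>y. \<chi> i j. if j = None then second_deriv y v w $ cols i else transpose (?B y) $ i $ j"
  let ?c = "\<lambda>y. \<chi> a. case a of None \<Rightarrow> - eps * h (\<psi> y) (frame v (\<psi> y)) (frame w (\<psi> y))
      | Some i \<Rightarrow> mdiff A \<phi> (\<psi> y) (nab (frame v) (frame w) (\<psi> y)) $ i"
  have eq: "h (\<psi> y) (frame v (\<psi> y)) (frame w (\<psi> y)) = (- eps) * (det (?C y) / det (?B y))"
    if y: "y \<in> \<phi> ` U" for y
  proof -
    let ?q = "\<psi> y"
    have q: "?q \<in> U" "\<phi> ?q = y" using y inv_in inv_right by auto
    have nz: "det (transpose (?B y)) \<noteq> 0" using det_Bmat_frame[OF q(1)] by (simp add: det_transpose)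
    have "(\<Sum>i\<in>UNIV. mdiff A \<phi> ?q u $ i *\<^sub>R frame (axis i 1) ?q) = u" for u
      using linear_axis_expand[OF frame_inverse(3)[OF q(1)], of "mdiff A \<phi> ?q u"] frame_inverse(2)[OF q(1)] by metis
    then have nab: "(\<Sum>i\<in>UNIV. ?c y $ Some i *\<^sub>R frame (axis i 1) ?q) = nab (frame v) (frame w) ?q"
      by simp
    have "(transpose (?B y) *v ?c y) $ b = second_deriv y v w $ cols b" for b
    proof -
      have "(transpose (?B y) *v ?c y) $ b = (\<Sum>a\<in>UNIV. ?c y $ a * ?B y $ a $ b)"
        by (rule transpose_mult_nth)
      also have "\<dots> = (mdiff A x ?q (nab (frame v) (frame w) ?q) + ?c y $ None *\<^sub>R x ?q) $ cols b"
        by (simp only: Bmat_combination nab)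
      also have "\<dots> = second_deriv y v w $ cols b"
        using structure_equation[OF q(1), of v w] q(2) by simp
      finally show ?thesis .
    qed
    then have "transpose (?B y) *v ?c y = (\<chi> i. second_deriv y v w $ cols i)"
      by (simp only: vec_eq_iff vec_lambda_beta simp_thms)
    then have "?c y = (\<chi> k. det (\<chi> i j. if j = k then (\<chi> i. second_deriv y v w $ cols i) $ i else transpose (?B y) $ i $ j) / det (transpose (?B y)))"
      using cramer[OF nz] by blast
    then have "?c y $ None = det (?C y) / det (?B y)" by (simp add: det_transpose cong: if_cong)
    then have e: "- eps * h ?q (frame v ?q) (frame w ?q) = det (?C y) / det (?B y)" by simp
    \<comment> \<open>As \<open>eps * eps = 1\<close>, multiplication by \<open>- eps\<close> undoes
      the factor \<open>- eps\<close> of the unknown.\<close>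
    show ?thesis unfolding e[symmetric] by (simp add: eps_sq mult.assoc[symmetric])
  qed
  have "smooth_on (\<phi> ` U) (\<lambda>y. (- eps) * (det (?C y) / det (?B y)))"
  proof (intro smooth_on_mult[OF open_img] smooth_on_divide[OF open_img] smooth_on_const smooth_on_det[OF open_img])
    show "smooth_on (\<phi> ` U) (\<lambda>y. ?C y $ i $ j)" for i j
    proof (cases j)
      case None
      then show ?thesis using smooth_on_vec_nth[OF open_img smooth_second_deriv] by simp
    next
      case (Some k)
      then show ?thesis using smooth_Bmat by (simp add: transpose_def)
    qed
    show "smooth_on (\<phi> ` U) (\<lambda>y. ?B y $ i $ j)" for i j by (rule smooth_Bmat)
    show "det (?B y) \<noteq> 0" if "y \<in> \<phi> ` U" for y using that det_Bmat_frame inv_in by blast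
  qed
  from smooth_on_transform[OF open_img this eq[symmetric]] show ?thesis .
qed

end

section \<open>Algebra of the metric and the logarithmic density ratio\<close>

context centroaffine
begin

lemma centroaffine_chartI: "(U, \<phi>) \<in> A \<Longrightarrow> centroaffine_chart A x eps nab nabh h U \<phi>"
  by (intro centroaffine_chart.intro centroaffine_axioms chart.intro smooth_atlas)

text \<open>The second derivative of \<open>x\<close> is symmetric, and linear in its first
  direction. Comparing the coefficients of \<open>x\<close> in the Gauss formula passes this on to
  \<open>h\<close>; all terms in \<open>nab\<close> stay in the tangential part.\<close>

lemma h_sym: "h p v w = h p w v" and h_linear: "linear (\<lambda>v. h p v w)"
proof -
  obtain U \<phi> where c: "chart_at A p = (U, \<phi>)" by fastforce
  interpret preferred_chart A U \<phi> p using preferred_chart_at[OF smooth_atlas, of p] c by simp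
  interpret centroaffine_chart A x eps nab nabh h U \<phi> by (rule centroaffine_chartI[OF chart_in])
  let ?G = "\<lambda>v w. nab (frame v) (frame w) p"
  have S: "second_deriv (\<phi> p) v w = mdiff A x p (?G v w) + (- eps * h p v w) *\<^sub>R x p" for v w
    using structure_equation[OF p_in] by (simp add: frame_self)
  have eps0: "eps \<noteq> 0" using eps by auto
  have "- eps * h p v w = - eps * h p w v"
    by (rule transversal_unique(2)[of p "?G v w" _ "?G w v"]) (use S second_deriv_sym[OF p_in] in metis)
  then show "h p v w = h p w v" using eps0 by simp
  note lin = second_deriv_linear[OF p_in, of w]
  show "linear (\<lambda>v. h p v w)"
  proof (rule linearI)
    fix v v'
    have "- eps * h p (v + v') w = - eps * h p v w + - eps * h p v' w"
      by (rule transversal_unique(2)[of p "?G (v + v') w" _ "?G v w + ?G v' w"])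
        (use linear_add[OF lin, of v v'] in \<open>simp add: S linear_add[OF linear_x] algebra_simps\<close>)
    then have "- eps * h p (v + v') w = - eps * (h p v w + h p v' w)" by (simp add: algebra_simps)
    then show "h p (v + v') w = h p v w + h p v' w" using eps0 by simp
  next
    fix c v
    have "- eps * h p (c *\<^sub>R v) w = c * (- eps * h p v w)"
      by (rule transversal_unique(2)[of p "?G (c *\<^sub>R v) w" _ "c *\<^sub>R ?G v w"])
        (use linear_scale[OF lin, of c v] in \<open>simp add: S linear_scale[OF linear_x] algebra_simps\<close>)
    then have "- eps * h p (c *\<^sub>R v) w = - eps * (c * h p v w)" by (simp add: algebra_simps)
    then show "h p (c *\<^sub>R v) w = c *\<^sub>R h p v w" using eps0 by simp
  qed
qed

lemma h_linear2: "linear (\<lambda>w. h p v w)"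
  using h_linear[of p v] h_sym by (metis (no_types, lifting) ext)

lemma h_nondegenerate: "(\<And>w. h p v w = h p v' w) \<Longrightarrow> v = v'"
  using pd linear_diff[OF h_linear] unfolding positive_definite_def
  by (metis eq_iff_diff_eq_0 less_irrefl)

text \<open>If \<open>c\<close> lies in the kernel, \<open>L c\<close> is orthogonal to every vector
  of the frame, hence to itself.\<close>

lemma det_Gram_nonzero:
  fixes L :: "real^'n \<Rightarrow> real^'n"
  assumes "linear L" "\<And>v. L v = 0 \<Longrightarrow> v = 0"
  shows "det (Gram q (\<lambda>i. L (axis i 1))) \<noteq> 0"
proof (rule det_nonzeroI)
  fix c :: "real^'n" assume c: "Gram q (\<lambda>i. L (axis i 1)) *v c = 0"
  have Lc: "L c = (\<Sum>i\<in>UNIV. c $ i *\<^sub>R L (axis i 1))" by (rule linear_axis_expand[OF assms(1)])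
  have row: "h q (L (axis i 1)) (L c) = 0" for i
  proof -
    have "h q (L (axis i 1)) (L c) = (Gram q (\<lambda>i. L (axis i 1)) *v c) $ i"
      by (simp add: Lc Gram_def matrix_vector_mult_def linear_sum[OF h_linear2] linear_scale[OF h_linear2] mult.commute)
    then show ?thesis using c by simp
  qed
  have "h q (L c) (L c) = (\<Sum>i\<in>UNIV. c $ i * h q (L (axis i 1)) (L c))"
    by (subst (1) Lc) (simp add: linear_sum[OF h_linear] linear_scale[OF h_linear])
  then have "h q (L c) (L c) = 0" using row by simp
  then have "L c = 0" using pd unfolding positive_definite_def by (metis less_irrefl)
  then show "c = 0" by (rule assms(2))
qed

text \<open>The volume of \<open>h\<close> is \<open>sqrt (det Gram)\<close>, so its logarithm is a
  quarter of \<open>ln ((det Gram)^2)\<close>, whereas \<open>ln \<bar>\<theta>\<bar>\<close> is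
  half of \<open>ln (\<theta>^2)\<close>.\<close>

definition log_density :: "'m \<Rightarrow> ('n \<Rightarrow> real^'n) \<Rightarrow> real" where
  "log_density q E = ln ((det (Bmat q E))\<^sup>2) / 2 - ln ((det (block 1 (Gram q E)))\<^sup>2) / 4"

text \<open>The logarithm of the ratio of the induced volume form to the volume of \<open>h\<close>.\<close>

definition log_ratio :: "'m \<Rightarrow> real" where
  "log_ratio q = log_density q (\<lambda>i. axis i 1)"

text \<open>A frame change multiplies \<open>det Bmat\<close> by one determinant and the bordered
  Gram determinant by its square; the weights \<open>1/2\<close> and \<open>1/4\<close> make these
  contributions cancel.\<close>

lemma log_ratio_eq:
  fixes L :: "real^'n \<Rightarrow> real^'n"
  assumes "linear L" "\<And>v. L v = 0 \<Longrightarrow> v = 0"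
  shows "log_ratio q = log_density q (\<lambda>i. L (axis i 1))"
proof -
  let ?E = "\<lambda>i. L (axis i 1)" and ?e = "\<lambda>i. axis i 1 :: real^'n"
  \<comment> \<open>Row \<open>i\<close> holds the components of the new vector \<open>?E i\<close>,
    so \<open>?J\<close> acts on \<open>Bmat\<close> from the left and on the Gram matrix from both
    sides.\<close>
  let ?J = "(\<chi> i j. ?E i $ j) :: real^'n^'n"
  have id: "linear (\<lambda>v::real^'n. v)" by (simp add: linear_iff)
  have E: "?E i = (\<Sum>j\<in>UNIV. ?E i $ j *\<^sub>R axis j 1)" for i by (rule vec_axis_expand)
  have B: "Bmat q ?E = block 1 ?J ** Bmat q ?e"
  proof -
    have "Bmat q ?E $ Some i $ b = (block 1 ?J ** Bmat q ?e) $ Some i $ b" for i b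
      using Bmat_combination[of "\<lambda>a. block 1 ?J $ Some i $ a" q ?e b] E[of i]
      by (simp add: matrix_matrix_mult_def Bmat_def[of q ?E] frame_row_def)
    moreover have "Bmat q ?E $ None $ b = (block 1 ?J ** Bmat q ?e) $ None $ b" for b
      using Bmat_combination[of "\<lambda>a. block 1 ?J $ None $ a" q ?e b]
      by (simp add: matrix_matrix_mult_def Bmat_def[of q ?E] frame_row_def linear_0[OF linear_x])
    ultimately show ?thesis by (intro option_mat_eqI) auto
  qed
  have "Gram q ?E $ i $ j = (?J ** Gram q ?e ** transpose ?J) $ i $ j" for i j
  proof -
    have "Gram q ?E $ i $ j = (\<Sum>k\<in>UNIV. \<Sum>l\<in>UNIV. ?E i $ k * (?E j $ l * h q (axis k 1) (axis l 1)))"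
      unfolding Gram_def
      by (simp add: linear_axis_expand[OF h_linear, of q "?E i"] linear_axis_expand[OF h_linear2, of q _ "?E j"]
          sum_distrib_left)
    also have "\<dots> = (\<Sum>l\<in>UNIV. \<Sum>k\<in>UNIV. ?E i $ k * (?E j $ l * h q (axis k 1) (axis l 1)))"
      by (rule sum.swap)
    also have "\<dots> = (?J ** Gram q ?e ** transpose ?J) $ i $ j"
      by (simp add: matrix_matrix_mult_def transpose_def Gram_def sum_distrib_left sum_distrib_right ac_simps)
    finally show ?thesis .
  qed
  then have "Gram q ?E = ?J ** Gram q ?e ** transpose ?J" by (simp only: vec_eq_iff simp_thms)
  then have H: "block 1 (Gram q ?E) = block 1 ?J ** block 1 (Gram q ?e) ** transpose (block 1 ?J)"
    by (simp add: block_mult transpose_block)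
  have b: "det (Bmat q ?e) \<noteq> 0" by (rule det_Bmat_nonzero[OF id])
  have g: "det (block 1 (Gram q ?e)) \<noteq> 0" by (rule det_block_nonzero[OF det_Gram_nonzero[OF id]])
  have j: "det (block 1 ?J) \<noteq> 0"
    using det_Bmat_nonzero[OF assms, of q] unfolding B by (auto simp: det_mul)
  have "ln ((det (Bmat q ?E))\<^sup>2) = ln ((det (block 1 ?J))\<^sup>2) + ln ((det (Bmat q ?e))\<^sup>2)"
    using b j unfolding B by (simp add: det_mul power_mult_distrib ln_mult)
  moreover have "ln ((det (block 1 (Gram q ?E)))\<^sup>2)
    = 2 * ln ((det (block 1 ?J))\<^sup>2) + ln ((det (block 1 (Gram q ?e)))\<^sup>2)"
    using g j unfolding H by (simp add: det_mul det_transpose power_mult_distrib ln_mult)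
  ultimately show ?thesis unfolding log_ratio_def log_density_def by (simp add: add_divide_distrib)
qed

end

section \<open>Logarithmic derivatives of the two volume forms\<close>

lemma has_derivative_log_density:
  fixes d e :: "'a::real_normed_vector \<Rightarrow> real"
  assumes "(d has_derivative (\<lambda>v. t v * d y)) (at y)" "(e has_derivative (\<lambda>v. s v * e y)) (at y)"
    "d y \<noteq> 0" "e y \<noteq> 0"
  shows "((\<lambda>y. ln ((d y)\<^sup>2) / 2 - ln ((e y)\<^sup>2) / 4) has_derivative (\<lambda>v. t v - s v / 2)) (at y)"
proof -
  have l: "((\<lambda>y. ln ((u y)\<^sup>2)) has_derivative (\<lambda>v. 2 * r v)) (at y)"
    if u: "(u has_derivative (\<lambda>v. r v * u y)) (at y)" "u y \<noteq> 0" for u :: "'a \<Rightarrow> real" and r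
  proof -
    have "((\<lambda>y. (u y)\<^sup>2) has_derivative (\<lambda>v. 2 * (r v * u y) * u y)) (at y)"
      using has_derivative_power[OF u(1), of 2] by (simp add: ac_simps)
    from has_derivative_ln[OF _ this] u(2) show ?thesis
      by (simp add: power2_eq_square field_simps zero_less_mult_iff linorder_neq_iff disj_commute)
  qed
  have "((\<lambda>y. ln ((d y)\<^sup>2) * (1 / 2) - ln ((e y)\<^sup>2) * (1 / 4)) has_derivative
      (\<lambda>v. 2 * t v * (1 / 2) - 2 * s v * (1 / 4))) (at y)"
    by (intro has_derivative_diff has_derivative_mult_left l assms)
  then show ?thesis by simp
qed

text \<open>With \<open>N\<close> a Gram matrix and \<open>G\<close> the matrix of a metric
  connection, the bracketed sum is the derivative of \<open>N\<close>, and \<open>K\<close> is the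
  inverse of \<open>N\<close>. Cyclicity gives both summands the trace of \<open>G\<close>; the
  factor 2 is later offset by the square root in the volume of \<open>h\<close>.\<close>

lemma trace_symmetric_derivative:
  fixes N G :: "real^'i^'i"
  assumes "N ** K = mat 1"
  shows "trace ((G ** N + N ** transpose G) ** K) = 2 * trace G"
proof -
  have K: "K ** N = mat 1" using assms matrix_left_right_inverse by blast
  have "trace (G ** N ** K) = trace G" by (simp add: matrix_mul_assoc[symmetric] assms)
  moreover have "trace (N ** transpose G ** K) = trace (transpose G ** (K ** N))"
    using trace_mul_sym[of N "transpose G ** K"] by (simp add: matrix_mul_assoc)
  moreover have "trace (transpose G) = trace G" by (simp add: trace_def transpose_def)
  moreover have "(G ** N + N ** transpose G) ** K = G ** N ** K + N ** transpose G ** K"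
    by (simp add: matrix_matrix_mult_def vec_eq_iff sum.distrib distrib_right)
  ultimately show ?thesis by (simp add: trace_add K)
qed

context centroaffine_chart
begin

lemma frame_zero: "q \<in> U \<Longrightarrow> frame v q = 0 \<Longrightarrow> v = 0"
  using frame_inverse(1) linear_0[OF linear_mdiff_chart] by metis

lemma log_ratio_frame: "q \<in> U \<Longrightarrow> log_ratio q = log_density q (\<lambda>i. frame (axis i 1) q)"
  by (rule log_ratio_eq[OF frame_inverse(3) frame_zero])

lemma det_Gram_frame: "q \<in> U \<Longrightarrow> det (Gram q (\<lambda>i. frame (axis i 1) q)) \<noteq> 0"
  by (rule det_Gram_nonzero[OF frame_inverse(3) frame_zero])

lemma smooth_block_Gram:
  "smooth_on (\<phi> ` U) (\<lambda>y. block 1 (Gram (\<psi> y) (\<lambda>i. frame (axis i 1) (\<psi> y))) $ a $ b)"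
  by (cases a; cases b) (simp_all add: smooth_on_const Gram_def smooth_h)

lemma smooth_log_ratio: "smooth_on (\<phi> ` U) (\<lambda>y. log_ratio (\<psi> y))"
proof -
  have "smooth_on (\<phi> ` U) (\<lambda>y. log_density (\<psi> y) (\<lambda>i. frame (axis i 1) (\<psi> y)))"
    unfolding log_density_def power2_eq_square
    by (intro smooth_on_diff smooth_on_divide smooth_on_ln smooth_on_mult smooth_on_det smooth_on_const
        open_img smooth_Bmat smooth_block_Gram)
      (auto simp: det_Bmat_frame det_block_nonzero det_Gram_frame inv_in zero_less_mult_iff linorder_neq_iff[symmetric] simp flip: neq_iff)
  then show ?thesis
    by (rule smooth_on_transform[OF open_img]) (simp add: log_ratio_frame inv_in)
qed

end

context centroaffine
begin

lemma smooth_map_log_ratio: "smooth_map A UNIV log_ratio"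
  unfolding smooth_map_def
proof clarify
  fix U \<phi> assume "(U, \<phi>) \<in> A"
  then interpret centroaffine_chart A x eps nab nabh h U \<phi> by (rule centroaffine_chartI)
  show "smooth_on (\<phi> ` (U \<inter> UNIV)) (log_ratio \<circ> \<psi>)"
    using smooth_log_ratio by (simp add: o_def)
qed

lemma metric:
  assumes "open W" "smooth_field A W X" "smooth_field A W Y" "smooth_field A W Z" "p \<in> W"
  shows "deriv_along A X (\<lambda>q. h q (Y q) (Z q)) p = h p (nabh X Y p) (Z p) + h p (Y p) (nabh X Z p)"
  using lc assms unfolding levi_civita_def by blast

lemma smooth_nabh:
  assumes "open W" "smooth_field A W X" "smooth_field A W Y"
  shows "smooth_field A W (nabh X Y)"
proof -
  have "affine_connection A nabh" using lc unfolding levi_civita_def by (rule conjunct1)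
  note * = this[unfolded affine_connection_def]
  show ?thesis
    by (rule conjunct1[OF mp[OF spec[OF spec[OF spec[OF *]]]]]) (use assms in simp)
qed

lemma torsion_free:
  assumes "open W" "smooth_field A W X" "smooth_field A W Y" "p \<in> W"
  shows "lie_bracket A X Y p = nabh X Y p - nabh Y X p"
proof -
  have "\<forall>W X Y. open W \<and> smooth_field A W X \<and> smooth_field A W Y \<longrightarrow>
      (\<forall>p\<in>W. nabh X Y p - nabh Y X p = lie_bracket A X Y p)"
    using lc unfolding levi_civita_def by blast
  then show ?thesis using assms by metis
qed

text \<open>Jacobi's formula for both determinants: the rows \<open>x, x\<^sub>*e\<^sub>i\<close> are differentiated by \<open>nab\<close>
  modulo \<open>x\<close>, and the Gram matrix by \<open>nabh\<close> acting on both sides, so that the logarithmic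
  derivatives are the traces of the two connections.\<close>

lemma mdiff_log_ratio:
  "mdiff A log_ratio p v = real CARD('n) * tchebychev_form A nab nabh p v"
proof -
  obtain U \<phi> where c: "chart_at A p = (U, \<phi>)" by fastforce
  interpret preferred_chart A U \<phi> p using preferred_chart_at[OF smooth_atlas, of p] c by simp
  interpret centroaffine_chart A x eps nab nabh h U \<phi> by (rule centroaffine_chartI[OF chart_in])
  let ?e = "\<lambda>i. axis i 1 :: real^'n"
  let ?E = "\<lambda>y i. frame (?e i) (\<psi> y)"
  have y: "\<phi> p \<in> \<phi> ` U" and p: "\<psi> (\<phi> p) = p" using p_in inv_left by auto
  have Ep: "?E (\<phi> p) = ?e" by (simp add: p frame_self)
  define M where "M y = Bmat (\<psi> y) (?E y)" for y
  define N where "N y = block 1 (Gram (\<psi> y) (?E y))" for y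
  define G where "G v = (\<chi> i j. nabh (frame v) (frame (?e i)) p $ j)" for v
  \<comment> \<open>Row \<open>None\<close> is the derivative of \<open>x\<close>, which is the
    tangent vector \<open>mdiff A x p v\<close>: its corner entry is \<open>0\<close>, so the extra
    index adds nothing to the trace. The other rows are the coefficients of the Gauss
    formula.\<close>
  define C :: "real^'n \<Rightarrow> real^('n option)^('n option)" where "C v = (\<chi> a b. case a of
      None \<Rightarrow> (case b of None \<Rightarrow> 0 | Some j \<Rightarrow> v $ j)
    | Some i \<Rightarrow> (case b of None \<Rightarrow> - eps * h p v (?e i) | Some j \<Rightarrow> nab (frame v) (frame (?e i)) p $ j))" for v
  have M: "((\<lambda>y. M y $ a $ b) has_derivative (\<lambda>v. (C v ** M (\<phi> p)) $ a $ b)) (at (\<phi> p))" for a b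
  proof -
    have M_eq: "M z $ a $ b = (case a of None \<Rightarrow> f z | Some i \<Rightarrow> frechet_derivative f (at z) (?e i)) $ cols b"
      if "z \<in> \<phi> ` U" for z
      using frame_row_coordinates[OF inv_in[OF that], of a] inv_right[OF that] by (cases a) (simp_all add: M_def Bmat_def)
    have CM: "(C v ** M (\<phi> p)) $ a $ b
      = (mdiff A x p (\<Sum>i\<in>UNIV. C v $ a $ Some i *\<^sub>R ?e i) + C v $ a $ None *\<^sub>R x p) $ cols b" for v
      using Bmat_combination[of "\<lambda>c. C v $ a $ c" p ?e b]
      by (simp add: M_def frame_self p matrix_matrix_mult_def)
    have CM': "(C v ** M (\<phi> p)) $ a $ b
      = (case a of None \<Rightarrow> frechet_derivative f (at (\<phi> p)) v | Some i \<Rightarrow> second_deriv (\<phi> p) v (?e i)) $ cols b" for v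
    proof (cases a)
      case None
      then show ?thesis
        using mdiff_smooth_map[OF smooth_x p_in, of v] unfolding CM
        by (simp add: C_def mdiff_self vec_axis_expand[symmetric])
    next
      case (Some i)
      then show ?thesis
        using structure_equation[OF p_in, of v "?e i"] unfolding CM
        by (simp add: C_def frame_self vec_axis_expand[symmetric])
    qed
    have "((\<lambda>z. (case a of None \<Rightarrow> f z | Some i \<Rightarrow> frechet_derivative f (at z) (?e i)) $ cols b) has_derivative
      (\<lambda>v. (C v ** M (\<phi> p)) $ a $ b)) (at (\<phi> p))"
      unfolding CM'
      by (cases a) (auto simp: second_deriv_def intro!: bounded_linear.has_derivative[OF bounded_linear_vec_nth]
          smooth_on_has_derivative[OF _ y] smooth_f smooth_on_frechet_derivative)
    then show ?thesis
      by (rule has_derivative_transform_within_open[OF _ open_img y]) (rule M_eq[symmetric])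
  qed
  have dM: "((\<lambda>y. det (M y)) has_derivative (\<lambda>v. trace (C v) * det (M (\<phi> p)))) (at (\<phi> p))"
    by (rule has_derivative_det_trace[OF M refl])
  have "det (N (\<phi> p)) \<noteq> 0"
    unfolding N_def by (rule det_block_nonzero[OF det_Gram_frame]) (simp add: p p_in)
  then obtain K where K: "N (\<phi> p) ** K = mat 1" using invertible_det_nz invertible_def by metis
  have N': "((\<lambda>y. N y $ a $ b) has_derivative
      (\<lambda>v. (block 0 (G v) ** N (\<phi> p) + N (\<phi> p) ** transpose (block 0 (G v))) $ a $ b)) (at (\<phi> p))" for a b
  proof -
    have gram: "((\<lambda>y. h (\<psi> y) (?E y i) (?E y j)) has_derivative
      (\<lambda>v. (G v ** Gram p ?e + Gram p ?e ** transpose (G v)) $ i $ j)) (at (\<phi> p))" for i j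
    proof -
      have d: "(\<lambda>y. h (\<psi> y) (?E y i) (?E y j)) differentiable at (\<phi> p)"
        by (rule smooth_on_differentiable[OF smooth_h y])
      have "frechet_derivative (\<lambda>y. h (\<psi> y) (?E y i) (?E y j)) (at (\<phi> p)) v
        = (G v ** Gram p ?e + Gram p ?e ** transpose (G v)) $ i $ j" for v
      proof -
        have "frechet_derivative (\<lambda>y. h (\<psi> y) (?E y i) (?E y j)) (at (\<phi> p)) v
          = deriv_along A (frame v) (\<lambda>q. h q (frame (?e i) q) (frame (?e j) q)) p"
          using mdiff_chain(1)[OF p_in d, of v] by (simp add: mdiff_self frame_self)
        also have "\<dots> = h p (nabh (frame v) (frame (?e i)) p) (?e j) + h p (?e i) (nabh (frame v) (frame (?e j)) p)"
          using metric[OF open_dom smooth_field_frame smooth_field_frame smooth_field_frame p_in] by (simp add: frame_self)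
        also have "\<dots> = (G v ** Gram p ?e + Gram p ?e ** transpose (G v)) $ i $ j"
          by (simp add: G_def Gram_def matrix_matrix_mult_def transpose_def mult.commute
              linear_axis_expand[OF h_linear, of p "nabh (frame v) (frame (?e i)) p"]
              linear_axis_expand[OF h_linear2, of p _ "nabh (frame v) (frame (?e j)) p"])
        finally show ?thesis .
      qed
      then have "frechet_derivative (\<lambda>y. h (\<psi> y) (?E y i) (?E y j)) (at (\<phi> p))
        = (\<lambda>v. (G v ** Gram p ?e + Gram p ?e ** transpose (G v)) $ i $ j)" by (rule ext)
      with d[unfolded frechet_derivative_works] show ?thesis by (simp only:)
    qed
    have "block 0 (G v) ** N (\<phi> p) + N (\<phi> p) ** transpose (block 0 (G v))
      = block 0 (G v ** Gram p ?e + Gram p ?e ** transpose (G v))" for v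
      by (simp add: N_def frame_self p block_mult transpose_block block_add)
    moreover have "N y $ None $ None = 1" "N y $ None $ Some j = 0" "N y $ Some i $ None = 0"
      "N y $ Some i $ Some j = h (\<psi> y) (?E y i) (?E y j)" for y i j
      by (simp_all add: N_def Gram_def)
    ultimately show ?thesis
      by (cases a; cases b) (simp_all only: block_nth gram has_derivative_const)
  qed
  have dN: "((\<lambda>y. det (N y)) has_derivative (\<lambda>v. 2 * trace (G v) * det (N (\<phi> p)))) (at (\<phi> p))"
  proof -
    let ?D = "\<lambda>v. block 0 (G v) ** N (\<phi> p) + N (\<phi> p) ** transpose (block 0 (G v))"
    \<comment> \<open>Since \<open>K\<close> is the inverse of \<open>N (\<phi> p)\<close>, the
      derivative takes the factored form that Jacobi's formula requires.\<close>
    have "?D v = (?D v ** K) ** N (\<phi> p)" for v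
      using K matrix_left_right_inverse[of "N (\<phi> p)" K] by (simp add: matrix_mul_assoc[symmetric])
    from has_derivative_det_trace[OF N' this] show ?thesis
      by (simp only: trace_symmetric_derivative[OF K] trace_block add_0)
  qed
  have nz: "det (M (\<phi> p)) \<noteq> 0" unfolding M_def by (rule det_Bmat_frame) (simp add: p p_in)
  have "((\<lambda>y. ln ((det (M y))\<^sup>2) / 2 - ln ((det (N y))\<^sup>2) / 4) has_derivative
      (\<lambda>v. trace (C v) - 2 * trace (G v) / 2)) (at (\<phi> p))"
    by (rule has_derivative_log_density[OF dM dN nz \<open>det (N (\<phi> p)) \<noteq> 0\<close>])
  then have "((\<lambda>y. log_ratio (\<psi> y)) has_derivative (\<lambda>v. trace (C v) - 2 * trace (G v) / 2)) (at (\<phi> p))"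
    by (rule has_derivative_transform_within_open[OF _ open_img y])
      (simp add: log_ratio_frame inv_in log_density_def M_def N_def)
  then have "mdiff A log_ratio p v = trace (C v) - trace (G v)"
    using mdiff_smooth_map[OF smooth_map_log_ratio p_in, of v]
    by (simp add: mdiff_self frechet_derivative_eqI)
  also have "trace (C v) = (\<Sum>i\<in>UNIV. nab (frame v) (frame (?e i)) p $ i)"
    by (simp add: trace_def sum_UNIV_option C_def)
  also have "\<dots> - trace (G v) = trace (matrix (difference_tensor A nab nabh p v))"
    by (simp add: trace_def G_def matrix_def difference_tensor_def coord_field_eq sum_subtractf)
  finally show ?thesis by (simp add: tchebychev_form_def)
qed

end

lemma closed_mdiff:
  fixes F :: "'m::{t2_space, second_countable_topology} \<Rightarrow> real"
    and A :: "('m, 'n::finite) chart set"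
  assumes "smooth_atlas A" "smooth_map A UNIV F"
  shows "closed_one_form A (mdiff A F)"
proof -
  have F: "smooth_map A W F" for W by (rule smooth_map_mono[OF assms(2)]) simp
  note c = chart_chart_at(1)[OF assms(1)]
  have "linear (mdiff A F p)" for p using chart.linear_mdiff[OF c assms(2)] by simp
  moreover have "smooth_map A W (deriv_along A X F)" if "open W" "smooth_field A W X" for W X
    by (rule chart.smooth_map_deriv_along[OF c that(1) F that(2)])
  moreover have "ext_deriv A (mdiff A F) X Y p = 0"
    if "open W" "smooth_field A W X" "smooth_field A W Y" "p \<in> W" for W X Y p
    unfolding ext_deriv_def mdiff_lie_bracket[OF assms(1) that(1) F that(2,3,4)] by simp
  ultimately show ?thesis by (auto simp: closed_one_form_def smooth_one_form_def)
qed

section \<open>Closedness, smoothness of the Tchebychev field, and the conformal criterion\<close>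

context centroaffine
begin

lemma tchebychev_form_exact:
  "\<exists>F. smooth_map A UNIV F \<and> tchebychev_form A nab nabh = mdiff A F"
proof -
  let ?F = "\<lambda>q. log_ratio q * (1 / real CARD('n))"
  have F: "smooth_map A UNIV ?F"
    unfolding smooth_map_def
  proof clarify
    fix U \<phi> assume "(U, \<phi>) \<in> A"
    then interpret chart A U \<phi> using smooth_atlas by unfold_locales
    show "smooth_on (\<phi> ` (U \<inter> UNIV)) (?F \<circ> \<psi>)"
      using smooth_on_mult[OF open_img smooth_mapD[OF smooth_map_log_ratio, simplified] smooth_on_const[of _ "1 / real CARD('n)"]]
      by (simp add: o_def)
  qed
  have "mdiff A ?F p v = tchebychev_form A nab nabh p v" for p v
  proof -
    interpret chart A "fst (chart_at A p)" "snd (chart_at A p)" by (rule chart_chart_at(1)[OF smooth_atlas])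
    note q = chart_at_in(2)[of p]
    note D = smooth_map_has_derivative[OF smooth_map_log_ratio q UNIV_I]
    have "mdiff A ?F p v = mdiff A log_ratio p v * (1 / real CARD('n))"
      using frechet_derivative_eqI[OF has_derivative_mult_left[OF D, of "1 / real CARD('n)"]]
        mdiff_smooth_map[OF F q UNIV_I] mdiff_smooth_map[OF smooth_map_log_ratio q UNIV_I] by simp
    then show ?thesis by (simp add: mdiff_log_ratio)
  qed
  then have "tchebychev_form A nab nabh = mdiff A ?F" by (simp only: fun_eq_iff simp_thms)
  then show ?thesis using F by blast
qed

lemma closed_tchebychev_form: "closed_one_form A (tchebychev_form A nab nabh)"
  using tchebychev_form_exact closed_mdiff[OF smooth_atlas] by metis

text \<open>Tested against a coordinate frame, the components of \<open>T\<close> solve a linear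
  system with the Gram matrix. Its right-hand side is smooth because the form is the differential of
  a smooth potential \<open>F\<close>, and Cramer's rule passes smoothness to the solution.\<close>

lemma smooth_tchebychev_field:
  assumes "tchebychev_field A nab nabh h T"
  shows "smooth_field A UNIV T"
proof -
  obtain F where F: "smooth_map A UNIV F" "tchebychev_form A nab nabh = mdiff A F"
    using tchebychev_form_exact by blast
  have T: "h q (T q) v = mdiff A F q v" for q v
    using assms F(2) unfolding tchebychev_field_def by simp
  have "smooth_on (\<phi> ` U) (\<lambda>y. mdiff A \<phi> (inv_into U \<phi> y) (T (inv_into U \<phi> y)))"
    if "(U, \<phi>) \<in> A" for U \<phi>
  proof -
    interpret centroaffine_chart A x eps nab nabh h U \<phi> by (rule centroaffine_chartI[OF that])
    let ?e = "\<lambda>i. axis i 1 :: real^'n"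
    let ?D = "\<lambda>y. frechet_derivative (\<lambda>y. F (\<psi> y)) (at y)"
    let ?N = "\<lambda>y. Gram (\<psi> y) (\<lambda>i. frame (?e i) (\<psi> y))"
    let ?P = "\<lambda>y k. \<chi> i j. if j = k then ?D y (?e i) else transpose (?N y) $ i $ j"
    have eq: "mdiff A \<phi> (\<psi> y) (T (\<psi> y)) = (\<chi> k. det (?P y k) / det (?N y))"
      if y: "y \<in> \<phi> ` U" for y
    proof -
      let ?q = "\<psi> y"
      have q: "?q \<in> U" "\<phi> ?q = y" using y inv_in inv_right by auto
      let ?t = "mdiff A \<phi> ?q (T ?q)"
      have Tq: "T ?q = (\<Sum>i\<in>UNIV. ?t $ i *\<^sub>R frame (?e i) ?q)"
        using linear_axis_expand[OF frame_inverse(3)[OF q(1)], of ?t] frame_inverse(2)[OF q(1)] by simp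
      have "(transpose (?N y) *v ?t) $ j = ?D y (?e j)" for j
      proof -
        have "(transpose (?N y) *v ?t) $ j = h ?q (\<Sum>i\<in>UNIV. ?t $ i *\<^sub>R frame (?e i) ?q) (frame (?e j) ?q)"
          by (simp only: transpose_mult_nth) (simp add: Gram_def linear_sum[OF h_linear] linear_scale[OF h_linear])
        also have "\<dots> = mdiff A F ?q (frame (?e j) ?q)" by (simp only: Tq[symmetric] T)
        also have "\<dots> = ?D y (?e j)" using mdiff_frame[OF F(1) q(1) UNIV_I] q(2) by simp
        finally show ?thesis .
      qed
      then have "transpose (?N y) *v ?t = (\<chi> j. ?D y (?e j))"
        by (simp only: vec_eq_iff vec_lambda_beta simp_thms)
      moreover have "det (transpose (?N y)) \<noteq> 0"
        unfolding det_transpose by (rule det_Gram_frame[OF q(1)])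
      ultimately have "?t = (\<chi> k. det (\<chi> i j. if j = k then (\<chi> j. ?D y (?e j)) $ i else transpose (?N y) $ i $ j)
          / det (transpose (?N y)))"
        using cramer by blast
      then show ?thesis by (simp add: det_transpose cong: if_cong)
    qed
    have "smooth_on (\<phi> ` U) (\<lambda>y. \<chi> k. det (?P y k) / det (?N y))"
    proof (intro smooth_on_vec_lambda[OF open_img] smooth_on_divide[OF open_img] smooth_on_det[OF open_img])
      show "smooth_on (\<phi> ` U) (\<lambda>y. ?P y k $ i $ j)" for k i j
        using smooth_on_frechet_derivative[OF smooth_mapD[OF F(1)]] smooth_h
        by (cases "j = k") (simp_all add: transpose_def Gram_def)
      show "smooth_on (\<phi> ` U) (\<lambda>y. ?N y $ i $ j)" for i j by (simp add: Gram_def smooth_h)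
      show "det (?N y) \<noteq> 0" if "y \<in> \<phi> ` U" for y using that det_Gram_frame inv_in by blast
    qed
    from smooth_on_transform[OF open_img this eq[symmetric]] show ?thesis .
  qed
  then show ?thesis by (rule chart.smooth_field_UNIVI[OF chart_chart_at(1)[OF smooth_atlas]])
qed

text \<open>In the exterior derivative of the Tchebychev form, metric compatibility produces
  covariant derivatives of \<open>T\<close>, \<open>X\<close> and \<open>Y\<close>; absence of
  torsion cancels those of \<open>X\<close> and \<open>Y\<close> against the bracket.\<close>

lemma covariant_diff_symmetric:
  assumes "tchebychev_field A nab nabh h T" "open W" "smooth_field A W X" "smooth_field A W Y" "p \<in> W"
  shows "h p (nabh X T p) (Y p) = h p (X p) (nabh Y T p)"
proof -
  have T: "smooth_field A W T" by (rule smooth_field_mono[OF smooth_tchebychev_field[OF assms(1)]]) simp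
  have form: "tchebychev_form A nab nabh q v = h q (T q) v" for q v
    using assms(1) unfolding tchebychev_field_def by simp
  have "ext_deriv A (tchebychev_form A nab nabh) X Y p = 0"
    using closed_tchebychev_form assms unfolding closed_one_form_def by blast
  then show ?thesis
    unfolding ext_deriv_def form
    using metric[OF assms(2,3) T assms(4,5)] metric[OF assms(2,4) T assms(3,5)]
      torsion_free[OF assms(2-5)] h_sym[of p "X p" "nabh Y T p"]
    by (simp add: linear_diff[OF h_linear2])
qed

text \<open>The terms \<open>nabh T X\<close> and \<open>nabh T Y\<close> cancel against the
  brackets; the two that remain are equal by symmetry, whence the factor 2.\<close>

lemma lie_derivative_tchebychev:
  assumes "tchebychev_field A nab nabh h T" "open W" "smooth_field A W X" "smooth_field A W Y" "p \<in> W"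
  shows "lie_derivative A T h X Y p = 2 * h p (nabh X T p) (Y p)"
proof -
  have T: "smooth_field A W T" by (rule smooth_field_mono[OF smooth_tchebychev_field[OF assms(1)]]) simp
  show ?thesis
    unfolding lie_derivative_def
    using metric[OF assms(2) T assms(3,4,5)] torsion_free[OF assms(2) T assms(3,5)]
      torsion_free[OF assms(2) T assms(4,5)] covariant_diff_symmetric[OF assms]
    by (simp add: linear_diff[OF h_linear] linear_diff[OF h_linear2])
qed

text \<open>Passage from tangent vectors at \<open>p\<close>, on which the Tchebychev operator is
  defined, to the smooth local fields that the identities require.\<close>

lemma coord_field_extends:
  obtains W where "open W" "p \<in> W" "\<And>v. smooth_field A W (coord_field A p v)" "\<And>v. coord_field A p v p = v"
proof -
  obtain U \<phi> where c: "chart_at A p = (U, \<phi>)" by fastforce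
  interpret preferred_chart A U \<phi> p using preferred_chart_at[OF smooth_atlas, of p] c by simp
  show thesis
    by (rule that[of U]) (simp_all add: open_dom p_in coord_field_eq smooth_field_frame frame_self)
qed

text \<open>The symmetry of \<open>nabh T\<close> makes the value of \<open>nabh X T\<close> at \<open>p\<close> depend on \<open>X p\<close> only.\<close>

lemma tchebychev_hypersurface_pointwise:
  assumes "tchebychev_field A nab nabh h T" "tchebychev_hypersurface A nabh T"
    "open W" "smooth_field A W X" "p \<in> W"
  shows "nabh X T p = (1 / real CARD('n) * divergence A nabh T p) *\<^sub>R X p"
proof (rule h_nondegenerate)
  fix w
  let ?f = "1 / real CARD('n) * divergence A nabh T p"
  obtain V where V: "open V" "p \<in> V" "\<And>v. smooth_field A V (coord_field A p v)" "\<And>v. coord_field A p v p = v"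
    by (rule coord_field_extends[of p]) blast
  have "h p (nabh X T p) (coord_field A p w p) = h p (X p) (nabh (coord_field A p w) T p)"
    by (rule covariant_diff_symmetric[OF assms(1), of "W \<inter> V"])
      (use assms V smooth_field_mono[OF assms(4), of "W \<inter> V"] smooth_field_mono[OF V(3), of "W \<inter> V"] in auto)
  also have "nabh (coord_field A p w) T p = ?f *\<^sub>R w"
    using assms(2) unfolding tchebychev_hypersurface_def covariant_diff_def by blast
  finally show "h p (nabh X T p) w = h p (?f *\<^sub>R X p) w"
    by (simp add: V(4) linear_scale[OF h_linear] linear_scale[OF h_linear2])
qed

text \<open>The trace in \<open>divergence\<close> is taken in jumping preferred bases. By
  proportionality the factor is also a single component, in a fixed chart, of the smooth field
  \<open>nabh X T\<close> for a coordinate field \<open>X\<close>.\<close>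

lemma smooth_divergence:
  assumes "tchebychev_field A nab nabh h T" "tchebychev_hypersurface A nabh T"
  shows "smooth_map A UNIV (\<lambda>p. 1 / real CARD('n) * divergence A nabh T p)"
    (is "smooth_map A UNIV ?f")
  unfolding smooth_map_def
proof clarify
  fix U \<phi> assume "(U, \<phi>) \<in> A"
  then interpret chart A U \<phi> using smooth_atlas by unfold_locales
  \<comment> \<open>Any index serves: component \<open>i\<close> of a multiple of the
    \<open>i\<close>-th coordinate field is the multiplier.\<close>
  define i :: 'n where "i = undefined"
  let ?e = "axis i 1 :: real^'n"
  have "smooth_field A U T" by (rule smooth_field_mono[OF smooth_tchebychev_field[OF assms(1)]]) simp
  with open_dom smooth_field_frame have "smooth_field A U (nabh (frame ?e) T)" by (rule smooth_nabh)
  from smooth_on_vec_nth[OF open_img smooth_fieldD[OF this, simplified]]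
  have "smooth_on (\<phi> ` U) (\<lambda>y. mdiff A \<phi> (\<psi> y) (nabh (frame ?e) T (\<psi> y)) $ i)" .
  then have "smooth_on (\<phi> ` U) (\<lambda>y. ?f (\<psi> y))"
  proof (rule smooth_on_transform[OF open_img])
    fix y assume "y \<in> \<phi> ` U"
    then have q: "\<psi> y \<in> U" by (rule inv_in)
    show "mdiff A \<phi> (\<psi> y) (nabh (frame ?e) T (\<psi> y)) $ i = ?f (\<psi> y)"
      unfolding tchebychev_hypersurface_pointwise[OF assms open_dom smooth_field_frame q]
        linear_scale[OF linear_mdiff_chart[OF q]] frame_inverse(1)[OF q] by simp
  qed
  then show "smooth_on (\<phi> ` (U \<inter> UNIV)) (?f \<circ> \<psi>)" by (simp add: o_def)
qed

lemma tchebychev_imp_conformal: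
  assumes "tchebychev_field A nab nabh h T" "tchebychev_hypersurface A nabh T"
  shows "conformal_field A h T"
  unfolding conformal_field_def
  using smooth_tchebychev_field[OF assms(1)] smooth_divergence[OF assms]
    lie_derivative_tchebychev[OF assms(1)] tchebychev_hypersurface_pointwise[OF assms]
  by (intro conjI exI[of _ "\<lambda>p. 1 / real CARD('n) * divergence A nabh T p"])
    (auto simp: linear_scale[OF h_linear])

lemma conformal_imp_tchebychev:
  assumes "tchebychev_field A nab nabh h T" "conformal_field A h T"
  shows "tchebychev_hypersurface A nabh T"
proof -
  obtain f where f: "\<And>W X Y p. open W \<Longrightarrow> smooth_field A W X \<Longrightarrow> smooth_field A W Y \<Longrightarrow> p \<in> W \<Longrightarrow>
      lie_derivative A T h X Y p = 2 * f p * h p (X p) (Y p)"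
    using assms(2) unfolding conformal_field_def by blast
  have eq: "covariant_diff A nabh T p v = f p *\<^sub>R v" for p v
    unfolding covariant_diff_def
  proof (rule h_nondegenerate)
    fix w
    obtain V where V: "open V" "p \<in> V" "\<And>v. smooth_field A V (coord_field A p v)" "\<And>v. coord_field A p v p = v"
      by (rule coord_field_extends[of p]) blast
    show "h p (nabh (coord_field A p v) T p) w = h p (f p *\<^sub>R v) w"
      using f[OF V(1) V(3) V(3) V(2), of v w] lie_derivative_tchebychev[OF assms(1) V(1) V(3) V(3) V(2), of v w]
      by (simp add: V(4) linear_scale[OF h_linear])
  qed
  \<comment> \<open>Taking the trace identifies the conformal factor with the divergence divided by
    the dimension.\<close>
  have "divergence A nabh T p = real CARD('n) * f p" for p
    by (simp add: divergence_def trace_def matrix_def eq)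
  then show ?thesis by (simp add: tchebychev_hypersurface_def eq)
qed

end

theorem lemma2p1:
  fixes A :: "('m::{t2_space, second_countable_topology}, 'n::finite) chart set"
    and x :: "'m \<Rightarrow> real ^ 'k::finite"
    and eps :: real
    and nab nabh :: "('m, 'n) conn"
    and h :: "('m, 'n) two_tensor"
    and T :: "('m, 'n) vfield"
  assumes "centroaffine_hypersurface A x"
    and "eps \<in> {1, -1}"
    and "centroaffine_decomposition A x eps nab h"
    and "positive_definite h"
    and "levi_civita A h nabh"
    and "tchebychev_field A nab nabh h T"
  shows "closed_one_form A (tchebychev_form A nab nabh) \<and>
         (tchebychev_hypersurface A nabh T \<longleftrightarrow> conformal_field A h T)"
proof -
  interpret centroaffine A x eps nab nabh h using assms by unfold_locales
  show ?thesis
    using closed_tchebychev_form tchebychev_imp_conformal conformal_imp_tchebychev assms(6) by blast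
qed

end
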